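(* Let $k>2$ and let $\mathcal D$ be a distribution over $\mathbb R^d$ with mean $\mu$ and $\sigma_k(\mathcal D)\le1$. Let $X_1,\dots,X_m\sim\mathcal D$ i.i.d. and $X=\frac1m\sum_{j=1}^mX_j$. Let $u\in\mathbb R^d$ and $\rho\ge0$. If $\rho\ge t_1$ for some $t_1=O\big(\sqrt{d\log m/m}\big)$, and $\|u-\mu\|_2\le\frac{\rho}{2\sqrt d}$, then \[ \big\|\mu-\mathbb E[\mathrm{clip}_{\rho,u}(X)]\big\|_2\le\tilde O\left(\frac{\sqrt d}{m\rho}\right)^{k-1}. \]
   Context: $\sigma_k(\mathcal D)=\sup_{\|v\|_2=1}\mathbb E_{Y\sim\mathcal D}[|\langle Y-\mu,v\rangle|^k]^{1/k}$. $\mathrm{clip}_{\rho,u}(x)=x$ if $\|x-u\|_2\le\rho$, and $u+\rho\frac{x-u}{\|x-u\|_2}$ otherwise. $\tilde O$ hides factors depending only on $k$ and polylogarithmic factors in $m$. *)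

theory Defs
  imports "HOL-Probability.Probability"
begin

text \<open>
  The dimension \<open>d\<close> has to be quantified inside the statement, after the constants hidden by the
  asymptotic notation, so it cannot be a type. A vector of $\mathbb{R}^d$ is a function
  \<open>nat \<Rightarrow> real\<close> of which only the coordinates \<open>i < d\<close> are ever used; the finite product of
  \<open>borel\<close> is the Borel sigma-algebra of $\mathbb{R}^d$.
\<close>

definition Rd :: "nat \<Rightarrow> (nat \<Rightarrow> real) measure" where
  "Rd d = PiM {..<d} (\<lambda>_. borel)"

definition norm2 :: "nat \<Rightarrow> (nat \<Rightarrow> real) \<Rightarrow> real" where
  "norm2 d x = L2_set x {..<d}"

definition inner_d :: "nat \<Rightarrow> (nat \<Rightarrow> real) \<Rightarrow> (nat \<Rightarrow> real) \<Rightarrow> real" where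
  "inner_d d x y = (\<Sum>i<d. x i * y i)"

definition distribution_on_Rd :: "nat \<Rightarrow> (nat \<Rightarrow> real) measure \<Rightarrow> bool" where
  "distribution_on_Rd d D \<longleftrightarrow> prob_space D \<and> sets D = sets (Rd d)"

text \<open>
  Expectations of random vectors are coordinatewise Bochner integrals, hence meaningful only when
  the coordinates are integrable; \<open>has_mean\<close> includes that requirement.
\<close>

definition vec_expectation :: "'a measure \<Rightarrow> ('a \<Rightarrow> nat \<Rightarrow> real) \<Rightarrow> nat \<Rightarrow> real" where
  "vec_expectation M f = (\<lambda>i. \<integral>x. f x i \<partial>M)"

definition has_mean :: "nat \<Rightarrow> (nat \<Rightarrow> real) measure \<Rightarrow> (nat \<Rightarrow> real) \<Rightarrow> bool" where
  "has_mean d D \<mu> \<longleftrightarrow>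
     (\<forall>i<d. integrable D (\<lambda>y. y i) \<and> \<mu> i = vec_expectation D (\<lambda>y. y) i)"

text \<open>
  The moments are taken in \<open>ennreal\<close>: with the Bochner integral, a distribution with an infinite
  \<open>k\<close>-th moment would get the value 0 instead of \<open>\<infinity>\<close>.
\<close>

definition ennreal_root :: "real \<Rightarrow> ennreal \<Rightarrow> ennreal" where
  "ennreal_root k a = (if a = \<infinity> then \<infinity> else ennreal (enn2real a powr (1 / k)))"

definition sigma_k :: "real \<Rightarrow> nat \<Rightarrow> (nat \<Rightarrow> real) measure \<Rightarrow> ennreal" where
  "sigma_k k d D =
     (SUP v \<in> {v. norm2 d v = 1}.
        ennreal_root k
          (\<integral>\<^sup>+ y. ennreal (\<bar>inner_d d (\<lambda>i. y i - vec_expectation D (\<lambda>y. y) i) v\<bar> powr k) \<partial>D))"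

definition clip :: "nat \<Rightarrow> real \<Rightarrow> (nat \<Rightarrow> real) \<Rightarrow> (nat \<Rightarrow> real) \<Rightarrow> (nat \<Rightarrow> real)" where
  "clip d \<rho> u x =
     (if norm2 d (\<lambda>i. x i - u i) \<le> \<rho> then x
      else (\<lambda>i. u i + \<rho> * ((x i - u i) / norm2 d (\<lambda>i. x i - u i))))"

text \<open>
  The law of an i.i.d. sample $X_1, \dots, X_m \sim D$ (indexed from 0), i.e. the product
  measure $D^m$.
\<close>

definition iid_sample :: "nat \<Rightarrow> (nat \<Rightarrow> real) measure \<Rightarrow> (nat \<Rightarrow> nat \<Rightarrow> real) measure" where
  "iid_sample m D = PiM {..<m} (\<lambda>_. D)"

definition sample_mean :: "nat \<Rightarrow> (nat \<Rightarrow> nat \<Rightarrow> real) \<Rightarrow> (nat \<Rightarrow> real)" where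
  "sample_mean m X = (\<lambda>i. (1 / real m) * (\<Sum>j<m. X j i))"

end

theory Submission
  imports Defs
begin

text \<open>
  Let \<open>S = m (X - \<mu>)\<close>, a sum of centred vectors \<open>Z\<^sub>j\<close>. In a unit direction \<open>v\<close>, clipping moves \<open>X\<close> by
  at most \<open>\<bar>\<langle>S, v\<rangle>\<bar> / m + \<rho> / (2 sqrt d)\<close>, and only on the event \<open>\<parallel>S\<parallel> > m \<rho> / 2\<close>. Put
  \<open>B = m \<rho> / 8\<close> and \<open>h = sqrt d / B\<close>. On that event some \<open>\<parallel>Z\<^sub>j\<parallel> > B\<close>, which has probability at
  most \<open>m h^k\<close> by Markov and leaves the other samples independent, or the sum of the \<open>Z\<^sub>j\<close>
  truncated at \<open>B\<close> exceeds \<open>4 B\<close>. The latter is controlled by a Fuk--Nagaev bound in Hilbert space: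
  Pinelis' potential \<open>cosh (l \<parallel>S\<parallel>)\<close> grows by a factor independent of \<open>d\<close> in each step, and
  optimizing \<open>l\<close> gives a tail \<open>exp (- 2 / (m h^2 exp k)) + (m h^k)^2\<close> up to constants, in
  which \<open>\<rho> \<ge> t1\<close> makes the Gaussian part negligible. Both cases contribute \<open>O(h^(k - 1))\<close>, so
  no logarithmic factor is lost and \<open>a = 0\<close> works.
\<close>

section \<open>Euclidean norm on coordinate functions\<close>

lemma norm2_nonneg [simp]: "0 \<le> norm2 d x"
  by (simp add: norm2_def)

lemma norm2_sq: "(norm2 d x)\<^sup>2 = (\<Sum>i<d. (x i)\<^sup>2)"
  by (simp add: norm2_def L2_set_def sum_nonneg)

lemma inner_d_self: "inner_d d x x = (norm2 d x)\<^sup>2"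
  unfolding norm2_sq inner_d_def by (simp add: power2_eq_square)

lemma norm2_cong: "(\<And>i. i < d \<Longrightarrow> x i = y i) \<Longrightarrow> norm2 d x = norm2 d y"
  unfolding norm2_def by (rule L2_set_cong) auto

lemma norm2_zero: "norm2 d (\<lambda>i. 0) = 0"
  by (simp add: norm2_def L2_set_def)

lemma norm2_scale: "norm2 d (\<lambda>i. c * x i) = \<bar>c\<bar> * norm2 d x"
  by (rule power2_eq_imp_eq) (auto simp: norm2_sq power_mult_distrib sum_distrib_left)

lemma norm2_triangle: "norm2 d (\<lambda>i. x i + y i) \<le> norm2 d x + norm2 d y"
  unfolding norm2_def by (rule L2_set_triangle_ineq)

lemma abs_inner_d_le: "\<bar>inner_d d x y\<bar> \<le> norm2 d x * norm2 d y"
proof -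
  have "\<bar>inner_d d x y\<bar> \<le> (\<Sum>i<d. \<bar>x i\<bar> * \<bar>y i\<bar>)"
    unfolding inner_d_def by (rule order_trans[OF sum_abs]) (simp add: abs_mult)
  also have "\<dots> \<le> norm2 d x * norm2 d y"
    unfolding norm2_def by (rule L2_set_mult_ineq)
  finally show ?thesis .
qed

lemma inner_d_add_left: "inner_d d (\<lambda>i. x i + y i) v = inner_d d x v + inner_d d y v"
  by (simp add: inner_d_def algebra_simps sum.distrib)

lemma inner_d_scale_left: "inner_d d (\<lambda>i. c * x i) v = c * inner_d d x v"
  by (simp add: inner_d_def algebra_simps sum_distrib_left)

lemma inner_d_commute: "inner_d d x y = inner_d d y x"
  by (simp add: inner_d_def mult.commute)

lemma inner_d_sum_left: "inner_d d (\<lambda>i. \<Sum>j\<in>J. x j i) v = (\<Sum>j\<in>J. inner_d d (x j) v)"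
  unfolding inner_d_def sum_distrib_right by (rule sum.swap)

lemma norm2_add_sq:
  "(norm2 d (\<lambda>i. x i + y i))\<^sup>2 = (norm2 d x)\<^sup>2 + (norm2 d y)\<^sup>2 + 2 * inner_d d x y"
  by (simp add: norm2_sq inner_d_def power2_sum sum.distrib sum_distrib_left mult.assoc)

section \<open>The hyperbolic cosine of the norm\<close>

text \<open>Power series with nonnegative coefficients are convex on the half-line.\<close>
lemma convex_on_cosh_sqrt: "convex_on {0..} (\<lambda>z. cosh (sqrt z))"
proof (rule convex_onI)
  have series: "(\<lambda>n. z ^ n / fact (2 * n)) sums cosh (sqrt z)" if "z \<ge> 0" for z :: real
  proof -
    have "(\<lambda>n. if even n then sqrt z ^ n /\<^sub>R fact n else 0) sums cosh (sqrt z)"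
      by (rule cosh_converges)
    \<comment> \<open>Only even exponents survive, so reindexing by \<open>2 * n\<close> leaves
      natural powers of \<open>z\<close> itself.\<close>
    then have "(\<lambda>n. (\<lambda>n. if even n then sqrt z ^ n /\<^sub>R fact n else 0) (2 * n)) sums cosh (sqrt z)"
      by (subst sums_mono_reindex) (auto simp: strict_mono_def elim!: evenE)
    moreover have "sqrt z ^ (2 * n) = z ^ n" for n
      using that by (simp add: power_mult)
    ultimately show ?thesis
      by (simp add: divide_inverse mult.commute)
  qed
  fix t x y :: real
  assume t: "t > 0" "t < 1" and xy: "x \<in> {0..}" "y \<in> {0..}"
  have "((1 - t) * x + t * y) ^ n \<le> (1 - t) * x ^ n + t * y ^ n" for n
  proof -
    have "convex_on {0..} (\<lambda>x::real. x ^ n)"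
      by (cases "even n") (auto intro: convex_on_subset[OF convex_power_even] convex_power_odd)
    from convex_onD[OF this, of t x y] show ?thesis using t xy by simp
  qed
  then have le: "((1 - t) * x + t * y) ^ n / fact (2 * n)
      \<le> (1 - t) * (x ^ n / fact (2 * n)) + t * (y ^ n / fact (2 * n))" for n
    by (simp add: field_simps)
  show "cosh (sqrt ((1 - t) *\<^sub>R x + t *\<^sub>R y)) \<le> (1 - t) * cosh (sqrt x) + t * cosh (sqrt y)"
    unfolding real_scaleR_def
    by (rule sums_le[OF le series sums_add[OF sums_mult[OF series] sums_mult[OF series]]])
      (use t xy in auto)
qed simp

lemma le_sinh: "(x::real) \<ge> 0 \<Longrightarrow> x \<le> sinh x"
proof -
  assume x: "x \<ge> 0"
  have "sinh 0 - 0 \<le> sinh x - x"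
    by (rule DERIV_nonneg_imp_nondecreasing[OF x, of "\<lambda>x. sinh x - x"])
      (auto intro!: exI derivative_eq_intros simp: cosh_real_ge_1)
  then show ?thesis by simp
qed

text \<open>By convexity in \<open>c\<close> only the collinear cases \<open>c = \<plusminus> a b\<close> have to be checked.\<close>
lemma cosh_sqrt_step:
  fixes a b c :: real
  assumes a: "a \<ge> 0" and b: "b \<ge> 0" and c: "\<bar>c\<bar> \<le> a * b"
  shows "cosh (sqrt (a\<^sup>2 + b\<^sup>2 + 2 * c)) \<le> cosh a + sinh a / a * c + cosh a * (exp b - 1 - b)"
proof (cases "a * b = 0")
  case True
  \<comment> \<open>Here \<open>c = 0\<close>, so the value \<open>sinh a / a = 0\<close> at
    \<open>a = 0\<close> does no harm; the case \<open>a = 0\<close> reduces to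
    \<open>cosh b \<le> exp b - b\<close>, that is \<open>b \<le> sinh b\<close>.\<close>
  then show ?thesis
    using a b c le_sinh[OF b] by (auto simp: cosh_plus_sinh[symmetric])
next
  case False
  then have ab: "a > 0" "b > 0" using a b by auto
  \<comment> \<open>\<open>t\<close> is the weight that writes \<open>c\<close> as a mixture of
    \<open>- a * b\<close> and \<open>a * b\<close>, at which the square root becomes
    \<open>\<bar>a - b\<bar>\<close> and \<open>a + b\<close>.\<close>
  define t where "t = (c + a * b) / (2 * (a * b))"
  have abp: "a * b > 0" using ab by simp
  have t: "0 \<le> t" "t \<le> 1" using c abp by (auto simp: t_def field_simps)
  have ct: "c = a * b * (2 * t - 1)" using ab by (simp add: t_def field_simps)
  have "a\<^sup>2 + b\<^sup>2 + 2 * c = (1 - t) *\<^sub>R (a - b)\<^sup>2 + t *\<^sub>R (a + b)\<^sup>2"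
    by (simp add: ct power2_eq_square algebra_simps)
  then have "cosh (sqrt (a\<^sup>2 + b\<^sup>2 + 2 * c)) \<le> (1 - t) * cosh (sqrt ((a - b)\<^sup>2)) + t * cosh (sqrt ((a + b)\<^sup>2))"
    using convex_onD[OF convex_on_cosh_sqrt t, of "(a - b)\<^sup>2" "(a + b)\<^sup>2"] by simp
  also have "\<dots> = (1 - t) * cosh (a - b) + t * cosh (a + b)"
    by simp
  also have "\<dots> \<le> (1 - t) * (cosh a - b * sinh a + cosh a * (exp b - 1 - b))
      + t * (cosh a + b * sinh a + cosh a * (exp b - 1 - b))"
  proof (intro add_mono mult_left_mono)
    \<comment> \<open>With \<open>exp b = cosh b + sinh b\<close>, this product is exactly the right
      side minus the left side of the bound for \<open>a - b\<close>; for \<open>a + b\<close> the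
      second factor becomes \<open>cosh a - sinh a\<close>.\<close>
    have "0 \<le> (sinh b - b) * (cosh a + sinh a)"
      using le_sinh[OF b] by (simp add: cosh_plus_sinh)
    then show "cosh (a - b) \<le> cosh a - b * sinh a + cosh a * (exp b - 1 - b)"
      by (simp add: cosh_diff cosh_plus_sinh[of b, symmetric] algebra_simps)
    have "0 \<le> (sinh b - b) * (cosh a - sinh a)"
      using le_sinh[OF b] by (simp add: cosh_minus_sinh)
    then show "cosh (a + b) \<le> cosh a + b * sinh a + cosh a * (exp b - 1 - b)"
      by (simp add: cosh_add cosh_plus_sinh[of b, symmetric] algebra_simps)
  qed (use t in auto)
  also have "\<dots> = cosh a + sinh a / a * c + cosh a * (exp b - 1 - b)"
    using ab by (simp add: ct algebra_simps)
  finally show ?thesis .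
qed

text \<open>Pinelis' one-step inequality: the middle term is linear in \<open>y\<close> and averages
  to zero for a centred vector, and the last is a multiple of the old potential. Only norms and one
  inner product enter, so no factor depending on \<open>d\<close> arises.\<close>

lemma cosh_norm2_step:
  "cosh (norm2 d (\<lambda>i. x i + y i)) \<le> cosh (norm2 d x)
     + sinh (norm2 d x) / norm2 d x * inner_d d x y
     + cosh (norm2 d x) * (exp (norm2 d y) - 1 - norm2 d y)"
proof -
  have "norm2 d (\<lambda>i. x i + y i) = sqrt ((norm2 d x)\<^sup>2 + (norm2 d y)\<^sup>2 + 2 * inner_d d x y)"
    unfolding norm2_add_sq[symmetric] by simp
  then show ?thesis
    using cosh_sqrt_step[of "norm2 d x" "norm2 d y" "inner_d d x y"] abs_inner_d_le by simp
qed

section \<open>Scalar inequalities for truncation, thresholds and power means\<close>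

lemma exp_minus_linear_le: "exp x - 1 - x \<le> x\<^sup>2 * exp x" if "x \<ge> 0" for x :: real
proof -
  have "1 - x \<le> exp (- x)" using exp_ge_add_one_self[of "- x"] by simp
  then have "exp x * (1 - x) \<le> 1"
    using mult_left_mono[of "1 - x" "exp (- x)" "exp x"] by (simp add: exp_minus)
  then have *: "exp x - 1 \<le> x * exp x" by (simp add: algebra_simps)
  then have "x * (exp x - 1) \<le> x * (x * exp x)" using that by (rule mult_left_mono)
  then show ?thesis using * by (simp add: power2_eq_square algebra_simps)
qed

text \<open>Below \<open>k / l\<close> the quadratic term dominates; above it, \<open>exp (l y) / y powr k\<close> is increasing,
  which is where the polynomial tail of Fuk and Nagaev comes from.\<close>
lemma truncated_exp_bound:
  fixes k l y B :: real
  assumes k: "k \<ge> 1" and l: "l \<ge> 0" and y: "y \<ge> 0" and B: "B > 0"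
  shows "(if y \<le> B then exp (l * y) - 1 - l * y else l * y)
    \<le> exp k * l\<^sup>2 * y\<^sup>2 + (y / B) powr k * exp (l * B)"
proof (cases "y \<le> B")
  case True
  show ?thesis
  proof (cases "l * y \<le> k")
    case le: True
    have "exp (l * y) - 1 - l * y \<le> (l * y)\<^sup>2 * exp (l * y)"
      using l y by (intro exp_minus_linear_le) simp
    also have "\<dots> \<le> (l * y)\<^sup>2 * exp k"
      using le by (intro mult_left_mono) auto
    finally show ?thesis
      using True by (simp add: power_mult_distrib mult_ac add_increasing2)
  next
    case False
    then have pos: "y > 0" using y k by (cases "y = 0") auto
    \<comment> \<open>Logarithmic form of comparing \<open>exp (l * y) / y powr k\<close> at
      \<open>y\<close> and at \<open>B\<close>, using \<open>ln x \<le> x - 1\<close> and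
      \<open>k < l * y\<close>.\<close>
    have "k * ln (B / y) \<le> k * (B / y - 1)"
      using pos B k by (intro mult_left_mono ln_le_minus_one) auto
    also have "\<dots> = k * ((B - y) / y)" using pos by (simp add: field_simps)
    also have "\<dots> \<le> l * y * ((B - y) / y)"
      using False True pos by (intro mult_right_mono) auto
    also have "\<dots> = l * (B - y)" using pos by simp
    finally have "l * y \<le> k * ln (y / B) + l * B"
      using pos B by (simp add: ln_div algebra_simps)
    then have "exp (l * y) \<le> (y / B) powr k * exp (l * B)"
      using pos B by (simp add: powr_def exp_add[symmetric])
    moreover have "0 \<le> exp k * l\<^sup>2 * y\<^sup>2" "0 \<le> l * y" using l y by simp_all
    ultimately show ?thesis unfolding if_P[OF True] by linarith
  qed
next
  case False
  \<comment> \<open>Beyond \<open>B\<close> the truncated vector is zero; what has to be absorbed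
    there is the size \<open>l * y\<close> of the linear term that truncation removes.\<close>
  have "l * y = (y / B) * (l * B)" using B by simp
  also have "\<dots> \<le> (y / B) powr k * exp (l * B)"
  proof (intro mult_mono)
    show "y / B \<le> (y / B) powr k"
      using powr_mono[of 1 k "y / B"] False B k y by simp
    show "l * B \<le> exp (l * B)" using exp_ge_add_one_self[of "l * B"] by linarith
  qed (use l y B in auto)
  finally show ?thesis using False by (simp add: add_increasing)
qed

text \<open>Above \<open>s\<close> one writes \<open>a = a powr (1 - k) * a powr k\<close> with a
  negative first exponent. Multiplied by an indicator, this trades a first moment on an event for
  its probability and a \<open>k\<close>-th moment, in place of Hoelder's inequality.\<close>

lemma le_threshold_add_powr:
  fixes a s k :: real
  assumes "k > 1" "s > 0" "a \<ge> 0"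
  shows "a \<le> s + s powr (1 - k) * a powr k"
proof (cases "a \<le> s")
  case True then show ?thesis by (simp add: add_increasing2)
next
  case False
  have "a = a powr (1 - k) * a powr k" using assms False by (simp add: powr_add[symmetric])
  also have "\<dots> \<le> s powr (1 - k) * a powr k"
    using assms False by (intro mult_right_mono powr_mono2') auto
  finally show ?thesis using assms by simp
qed

text \<open>Jensen's inequality with equal weights. Zero summands are dropped first so that
  convexity is used at positive arguments only; the smaller index set can only improve the
  factor.\<close>

lemma powr_sum_le:
  fixes a :: "'a \<Rightarrow> real"
  assumes "finite I" "p \<ge> 1" and nn: "\<And>i. i \<in> I \<Longrightarrow> 0 \<le> a i"
  shows "(\<Sum>i\<in>I. a i) powr p \<le> real (card I) powr (p - 1) * (\<Sum>i\<in>I. a i powr p)"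
proof -
  define J where "J = {i\<in>I. a i > 0}"
  have J: "finite J" "J \<subseteq> I" using assms by (auto simp: J_def)
  have sumJ: "(\<Sum>i\<in>I. a i) = (\<Sum>i\<in>J. a i)" "(\<Sum>i\<in>I. a i powr p) = (\<Sum>i\<in>J. a i powr p)"
    using nn by (auto intro!: sum.mono_neutral_right simp: J_def assms less_le)
  show ?thesis
  proof (cases "J = {}")
    case True then show ?thesis by (simp add: sumJ)
  next
    case False
    define n where "n = real (card J)"
    have n: "n > 0" using False J by (simp add: n_def card_gt_0_iff)
    have "(\<Sum>i\<in>J. (1 / n) *\<^sub>R a i) powr p \<le> (\<Sum>i\<in>J. (1 / n) * a i powr p)"
      using J False n
      by (intro convex_on_sum[OF _ _ powr_convex[OF assms(2)]]) (auto simp: J_def n_def)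
    then have "((\<Sum>i\<in>J. a i) / n) powr p \<le> (\<Sum>i\<in>J. a i powr p) / n"
      by (simp add: sum_divide_distrib)
    then have "(\<Sum>i\<in>J. a i) powr p \<le> n powr (p - 1) * (\<Sum>i\<in>J. a i powr p)"
      using n by (simp add: powr_divide powr_diff field_simps sum_nonneg J_def)
    also have "\<dots> \<le> real (card I) powr (p - 1) * (\<Sum>i\<in>J. a i powr p)"
      using J n assms by (intro mult_right_mono powr_mono2) (auto simp: n_def card_mono sum_nonneg)
    finally show ?thesis by (simp add: sumJ)
  qed
qed

section \<open>Tail of the truncated sum\<close>

lemma (in prob_space) integral_le_of_nn_integral_le:
  fixes f :: "'a \<Rightarrow> real"
  assumes [measurable]: "f \<in> borel_measurable M" and nn: "\<And>x. 0 \<le> f x"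
    and le: "(\<integral>\<^sup>+ x. ennreal (f x) \<partial>M) \<le> ennreal c" and c: "c \<ge> 0"
  shows "integrable M f" "(\<integral>x. f x \<partial>M) \<le> c"
proof -
  show "integrable M f"
    using le nn by (intro integrableI_nonneg) (auto simp: order.strict_trans1 ennreal_less_top)
  then have "ennreal (\<integral>x. f x \<partial>M) \<le> ennreal c"
    using le nn by (simp add: nn_integral_eq_integral)
  then show "(\<integral>x. f x \<partial>M) \<le> c" using c by simp
qed

lemma measurable_norm2 [measurable (raw)]:
  assumes "\<And>i. (\<lambda>x. f x i) \<in> borel_measurable M"
  shows "(\<lambda>x. norm2 d (f x)) \<in> borel_measurable M"
  unfolding norm2_def L2_set_def using assms by measurable

lemma measurable_inner_d [measurable (raw)]:
  assumes "\<And>i. (\<lambda>x. f x i) \<in> borel_measurable M"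
  shows "(\<lambda>x. inner_d d (f x) v) \<in> borel_measurable M"
  unfolding inner_d_def using assms by measurable

lemma measurable_cosh [measurable]: "(cosh :: real \<Rightarrow> real) \<in> borel_measurable borel"
  by (intro borel_measurable_continuous_onI continuous_intros)

lemma measurable_iid_sum:
  assumes "\<And>i. (\<lambda>y. g y i :: real) \<in> borel_measurable D"
  shows "(\<lambda>X. \<Sum>j\<in>J. g (X j) i) \<in> borel_measurable (PiM J (\<lambda>_. D))"
  by (intro borel_measurable_sum measurable_compose[OF _ assms]) measurable

text \<open>A supermartingale argument by Fubini: each sample integrated out raises the index of
  \<open>\<Psi>\<close> by one, with the remaining partial sum serving as the base point. It serves
  both the exponential potential and the second moment of sums.\<close>

lemma nn_integral_iid_sum_le:
  fixes \<Psi> :: "nat \<Rightarrow> (nat \<Rightarrow> real) \<Rightarrow> ennreal" and g :: "'a \<Rightarrow> nat \<Rightarrow> real"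
  assumes D: "prob_space D" and J: "finite J"
    and g [measurable]: "\<And>i. (\<lambda>y. g y i) \<in> borel_measurable D"
    and \<Psi>: "\<And>n. \<Psi> n \<in> borel_measurable (PiM UNIV (\<lambda>_. borel))"
    and step: "\<And>n s. (\<integral>\<^sup>+ y. \<Psi> n (\<lambda>i. s i + g y i) \<partial>D) \<le> \<Psi> (Suc n) s"
  shows "(\<integral>\<^sup>+ X. \<Psi> n (\<lambda>i. s i + (\<Sum>j\<in>J. g (X j) i)) \<partial>PiM J (\<lambda>_. D)) \<le> \<Psi> (n + card J) s"
  using J
proof (induction J arbitrary: n)
  case empty
  interpret product_sigma_finite "\<lambda>_::'b. D"
    using D by (simp add: product_sigma_finite_def prob_space_imp_sigma_finite)
  show ?case by (simp add: prob_space.emeasure_space_1[OF prob_space_PiM[OF D]])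
next
  case (insert j J)
  interpret product_sigma_finite "\<lambda>_::'b. D"
    using D by (simp add: product_sigma_finite_def prob_space_imp_sigma_finite)
  have meas: "(\<lambda>X. \<Psi> n (\<lambda>i. s i + (\<Sum>j\<in>K. g (X j) i))) \<in> borel_measurable (PiM K (\<lambda>_. D))" for n K
    by (rule measurable_compose[OF _ \<Psi>], rule measurable_PiM_single') auto
  have "(\<integral>\<^sup>+ X. \<Psi> n (\<lambda>i. s i + (\<Sum>j\<in>insert j J. g (X j) i)) \<partial>PiM (insert j J) (\<lambda>_. D))
      = (\<integral>\<^sup>+ X. \<integral>\<^sup>+ y. \<Psi> n (\<lambda>i. s i + (\<Sum>l\<in>insert j J. g ((X(j := y)) l) i)) \<partial>D \<partial>PiM J (\<lambda>_. D))"
    by (rule product_nn_integral_insert[OF insert.hyps meas])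
  also have "\<dots> = (\<integral>\<^sup>+ X. \<integral>\<^sup>+ y. \<Psi> n (\<lambda>i. (s i + (\<Sum>l\<in>J. g (X l) i)) + g y i) \<partial>D \<partial>PiM J (\<lambda>_. D))"
  proof -
    have "(\<Sum>l\<in>J. g (if l = j then y else X l) i) = (\<Sum>l\<in>J. g (X l) i)" for X y i
      using insert.hyps by (intro sum.cong) auto
    then show ?thesis
      using insert.hyps by (simp add: add_ac fun_upd_def)
  qed
  also have "\<dots> \<le> (\<integral>\<^sup>+ X. \<Psi> (Suc n) (\<lambda>i. s i + (\<Sum>l\<in>J. g (X l) i)) \<partial>PiM J (\<lambda>_. D))"
    by (intro nn_integral_mono step)
  also have "\<dots> \<le> \<Psi> (Suc n + card J) s" by (rule insert.IH)
  finally show ?case using insert.hyps by simp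
qed

section \<open>Moments and tails of one sample, and exponential moments of truncated sums\<close>

locale moment_bound = prob_space D for D :: "(nat \<Rightarrow> real) measure" +
  fixes k :: real and d :: nat and \<mu> :: "nat \<Rightarrow> real"
  assumes k_gt: "k > 2" and d_ge: "d \<ge> 1"
    and sets_D: "sets D = sets (Rd d)"
    and mean: "has_mean d D \<mu>"
    and moment: "\<And>v. norm2 d v = 1 \<Longrightarrow>
      (\<integral>\<^sup>+ y. ennreal (\<bar>inner_d d (\<lambda>i. y i - \<mu> i) v\<bar> powr k) \<partial>D) \<le> 1"
begin

definition dev :: "(nat \<Rightarrow> real) \<Rightarrow> nat \<Rightarrow> real" where
  "dev y = (\<lambda>i. y i - \<mu> i)"

text \<open>Large deviations are set to zero and the result is not recentred, so the truncated sum
  equals the true one as soon as no sample exceeds \<open>B\<close>. The lost mean is paid for in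
  \<open>exp_step\<close>.\<close>

definition trunc :: "real \<Rightarrow> (nat \<Rightarrow> real) \<Rightarrow> nat \<Rightarrow> real" where
  "trunc B y = (\<lambda>i. if norm2 d (dev y) \<le> B then dev y i else 0)"

lemma measurable_coord [measurable]: "(\<lambda>y. y i) \<in> borel_measurable D"
proof (cases "i < d")
  case True
  then show ?thesis
    using measurable_component_singleton[of i "{..<d}" "\<lambda>_. borel"]
    unfolding measurable_cong_sets[OF sets_D refl] Rd_def by simp
next
  case False
  \<comment> \<open>Points of the product space are \<open>undefined\<close> outside
    \<open>{..<d}\<close>, so these coordinates are constant; measurability then holds for every
    index.\<close>
  have "space D = space (Rd d)" by (rule sets_eq_imp_space_eq[OF sets_D])
  then have "y i = undefined" if "y \<in> space D" for y
    using that False by (auto simp: Rd_def space_PiM PiE_def extensional_def)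
  then show ?thesis
    by (subst measurable_cong[where g = "\<lambda>_. undefined"]) auto
qed

lemma measurable_dev [measurable]: "(\<lambda>y. dev y i) \<in> borel_measurable D"
  unfolding dev_def by measurable

lemma measurable_trunc [measurable]: "(\<lambda>y. trunc B y i) \<in> borel_measurable D"
  unfolding trunc_def by measurable

lemma integrable_coord: "i < d \<Longrightarrow> integrable D (\<lambda>y. y i)"
  and integral_coord: "i < d \<Longrightarrow> (\<integral>y. y i \<partial>D) = \<mu> i"
  using mean by (auto simp: has_mean_def vec_expectation_def)

lemma integrable_inner_dev: "integrable D (\<lambda>y. inner_d d (dev y) v)"
  and integral_inner_dev: "(\<integral>y. inner_d d (dev y) v \<partial>D) = 0"
  unfolding inner_d_def dev_def
  by (auto intro!: integrable_coord simp: integrable_coord integral_coord prob_space)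

text \<open>The constant 2 comes from splitting at \<open>\<bar>x\<bar> = 1\<close>: a square is at
  most 1 or at most the \<open>k\<close>-th power.\<close>

lemma moment_sq:
  assumes "norm2 d v = 1"
  shows "(\<integral>\<^sup>+ y. ennreal ((inner_d d (dev y) v)\<^sup>2) \<partial>D) \<le> 2"
proof -
  have "x\<^sup>2 \<le> 1 + \<bar>x\<bar> powr k" for x :: real
  proof (cases "\<bar>x\<bar> \<le> 1")
    case True
    then have "x\<^sup>2 \<le> 1" by (simp add: abs_square_le_1)
    then show ?thesis by (simp add: add_increasing2)
  next
    case False
    then have "\<bar>x\<bar> powr 2 \<le> \<bar>x\<bar> powr k" using k_gt by (intro powr_mono) auto
    then show ?thesis using False by (simp add: powr_numeral)
  qed
  then have "ennreal (x\<^sup>2) \<le> 1 + ennreal (\<bar>x\<bar> powr k)" for x :: real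
    using ennreal_leI[of "x\<^sup>2" "1 + \<bar>x\<bar> powr k"] by simp
  then have "(\<integral>\<^sup>+ y. ennreal ((inner_d d (dev y) v)\<^sup>2) \<partial>D)
      \<le> (\<integral>\<^sup>+ y. (1 + ennreal (\<bar>inner_d d (dev y) v\<bar> powr k)) \<partial>D)"
    by (intro nn_integral_mono)
  also have "\<dots> = 1 + (\<integral>\<^sup>+ y. ennreal (\<bar>inner_d d (dev y) v\<bar> powr k) \<partial>D)"
    by (subst nn_integral_add) (auto simp: emeasure_space_1)
  also have "\<dots> \<le> 1 + 1"
    using moment[OF assms] by (intro add_left_mono) (simp add: dev_def)
  finally show ?thesis by simp
qed

lemma coord_as_inner:
  assumes "i < d"
  shows "norm2 d (\<lambda>j. of_bool (j = i)) = 1" "inner_d d x (\<lambda>j. of_bool (j = i)) = x i"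
proof -
  have eq: "(\<Sum>j<d. f j * of_bool (j = i)) = f i" for f :: "nat \<Rightarrow> real"
    using assms by (simp add: of_bool_def if_distrib sum.delta cong: if_cong)
  show "inner_d d x (\<lambda>j. of_bool (j = i)) = x i" for x
    unfolding inner_d_def by (rule eq)
  from this[of "\<lambda>j. of_bool (j = i)"] show "norm2 d (\<lambda>j. of_bool (j = i)) = 1"
    unfolding inner_d_self using power2_eq_imp_eq[of "norm2 d (\<lambda>j. of_bool (j = i))" 1] by simp
qed

lemma norm_moment_sq: "(\<integral>\<^sup>+ y. ennreal ((norm2 d (dev y))\<^sup>2) \<partial>D) \<le> ennreal (2 * d)"
proof -
  have "(\<integral>\<^sup>+ y. ennreal ((norm2 d (dev y))\<^sup>2) \<partial>D) = (\<Sum>i<d. \<integral>\<^sup>+ y. ennreal ((dev y i)\<^sup>2) \<partial>D)"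
    by (subst nn_integral_sum[symmetric]) (auto simp: norm2_sq sum_ennreal)
  also have "\<dots> \<le> (\<Sum>i<d. 2)"
    using moment_sq[OF coord_as_inner(1)] by (intro sum_mono) (simp add: coord_as_inner(2))
  also have "\<dots> = ennreal (2 * d)"
    by (simp add: ennreal_mult'' mult.commute ennreal_of_nat_eq_real_of_nat)
  finally show ?thesis .
qed

text \<open>The power mean inequality with exponent \<open>k / 2\<close>, applied to the squared
  coordinates, costs \<open>d powr (k / 2 - 1)\<close>; the \<open>d\<close> coordinate moments,
  each at most 1, supply the missing factor \<open>d\<close>.\<close>

lemma norm_moment: "(\<integral>\<^sup>+ y. ennreal (norm2 d (dev y) powr k) \<partial>D) \<le> ennreal (sqrt d powr k)"
proof -
  have eq: "x powr k = (x\<^sup>2) powr (k / 2)" if "x \<ge> 0" for x :: real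
    using that by (cases "x = 0") (auto simp: powr_powr simp flip: powr_numeral)
  have "norm2 d x powr k \<le> d powr (k / 2 - 1) * (\<Sum>i<d. \<bar>x i\<bar> powr k)" for x
  proof -
    have "norm2 d x powr k = (\<Sum>i<d. (x i)\<^sup>2) powr (k / 2)"
      by (simp add: eq norm2_sq)
    also have "\<dots> \<le> real (card {..<d}) powr (k / 2 - 1) * (\<Sum>i<d. ((x i)\<^sup>2) powr (k / 2))"
      using k_gt by (intro powr_sum_le) auto
    finally show ?thesis by (simp add: eq[of "\<bar>_\<bar>"])
  qed
  then have "(\<integral>\<^sup>+ y. ennreal (norm2 d (dev y) powr k) \<partial>D)
      \<le> (\<integral>\<^sup>+ y. ennreal (d powr (k / 2 - 1)) * (\<Sum>i<d. ennreal (\<bar>dev y i\<bar> powr k)) \<partial>D)"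
    by (intro nn_integral_mono) (simp add: sum_ennreal ennreal_leI flip: ennreal_mult')
  also have "\<dots> = ennreal (d powr (k / 2 - 1)) * (\<Sum>i<d. \<integral>\<^sup>+ y. ennreal (\<bar>dev y i\<bar> powr k) \<partial>D)"
    by (simp add: nn_integral_cmult nn_integral_sum del: sum_ennreal)
  also have "\<dots> \<le> ennreal (d powr (k / 2 - 1)) * (\<Sum>i<d. 1)"
    using moment[OF coord_as_inner(1)]
    by (intro mult_left_mono sum_mono) (simp_all add: coord_as_inner(2) dev_def)
  also have "\<dots> = ennreal (d powr (k / 2 - 1) * d)"
    by (simp add: ennreal_mult'' ennreal_of_nat_eq_real_of_nat)
  also have "d powr (k / 2 - 1) * d = d powr (k / 2)"
    using d_ge by (simp add: powr_diff)
  also have "\<dots> = sqrt d powr k" by (simp add: eq[of "sqrt d"])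
  finally show ?thesis .
qed

lemma tail_norm:
  assumes B: "B > 0"
  shows "(\<integral>\<^sup>+ y. ennreal (of_bool (B < norm2 d (dev y))) \<partial>D) \<le> ennreal ((sqrt d / B) powr k)"
proof -
  have "of_bool (B < x) \<le> (1 / B) powr k * x powr k" if "x \<ge> 0" for x :: real
  proof (cases "B < x")
    case True
    have "1 \<le> (x / B) powr k" using True B k_gt by (intro ge_one_powr_ge_zero) auto
    then show ?thesis using True B by (simp add: powr_divide)
  qed (use B in auto)
  then have "(\<integral>\<^sup>+ y. ennreal (of_bool (B < norm2 d (dev y))) \<partial>D)
      \<le> (\<integral>\<^sup>+ y. ennreal ((1 / B) powr k) * ennreal (norm2 d (dev y) powr k) \<partial>D)"
    by (intro nn_integral_mono) (simp add: ennreal_leI flip: ennreal_mult')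
  also have "\<dots> \<le> ennreal ((1 / B) powr k) * ennreal (sqrt d powr k)"
    by (simp add: nn_integral_cmult mult_left_mono norm_moment)
  finally show ?thesis using B by (simp add: powr_divide flip: ennreal_mult')
qed

text \<open>With threshold \<open>1 / h\<close>, the tail probability \<open>h powr k\<close> and
  the directional moment 1 contribute \<open>h powr (k - 1)\<close> each.\<close>

lemma inner_on_tail:
  assumes B: "B > 0" and v: "norm2 d v = 1"
  shows "(\<integral>\<^sup>+ y. ennreal (\<bar>inner_d d (dev y) v\<bar> * of_bool (B < norm2 d (dev y))) \<partial>D)
    \<le> ennreal (2 * (sqrt d / B) powr (k - 1))"
proof -
  define h where "h = sqrt d / B"
  have h: "h > 0" using B d_ge by (simp add: h_def)
  have "a * of_bool P \<le> (1 / h) * of_bool P + (1 / h) powr (1 - k) * a powr k" if "a \<ge> 0" for a P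
    using le_threshold_add_powr[of k "1 / h" a] k_gt h that by (cases P) auto
  then have "(\<integral>\<^sup>+ y. ennreal (\<bar>inner_d d (dev y) v\<bar> * of_bool (B < norm2 d (dev y))) \<partial>D)
     \<le> (\<integral>\<^sup>+ y. ennreal (1 / h) * ennreal (of_bool (B < norm2 d (dev y)))
          + ennreal ((1 / h) powr (1 - k)) * ennreal (\<bar>inner_d d (dev y) v\<bar> powr k) \<partial>D)"
    using h by (intro nn_integral_mono)
      (simp add: ennreal_leI flip: ennreal_mult' ennreal_plus)
  also have "\<dots> = ennreal (1 / h) * (\<integral>\<^sup>+ y. ennreal (of_bool (B < norm2 d (dev y))) \<partial>D)
      + ennreal ((1 / h) powr (1 - k)) * (\<integral>\<^sup>+ y. ennreal (\<bar>inner_d d (dev y) v\<bar> powr k) \<partial>D)"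
    by (simp add: nn_integral_add nn_integral_cmult)
  also have "\<dots> \<le> ennreal (1 / h) * ennreal (h powr k) + ennreal ((1 / h) powr (1 - k)) * 1"
    using tail_norm[OF B] moment[OF v]
    by (intro add_mono mult_left_mono) (auto simp: h_def dev_def)
  also have "\<dots> = ennreal ((1 / h) * h powr k + (1 / h) powr (1 - k))"
    using h by (simp flip: ennreal_mult' ennreal_plus)
  also have "(1 / h) * h powr k + (1 / h) powr (1 - k) = 2 * h powr (k - 1)"
    using h by (simp add: powr_divide powr_diff)
  finally show ?thesis by (simp add: h_def)
qed

text \<open>Truncation spoils the centring, so the majorant \<open>R\<close> keeps the linear term
  in \<open>dev\<close> rather than in \<open>trunc\<close>; it integrates to zero, and only
  \<open>G\<close> contributes to the growth factor.\<close>

lemma exp_step: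
  assumes B: "B > 0" and l: "l \<ge> 0"
  shows "(\<integral>\<^sup>+ y. ennreal (cosh (norm2 d (\<lambda>i. s i + l * trunc B y i))) \<partial>D)
    \<le> ennreal (cosh (norm2 d s) * (1 + exp k * l\<^sup>2 * (2 * d) + (sqrt d / B) powr k * exp (l * B)))"
proof -
  define a where "a = norm2 d s"
  define N where "N y = norm2 d (dev y)" for y
  define G where "G y = exp k * l\<^sup>2 * (N y)\<^sup>2 + (N y / B) powr k * exp (l * B)" for y
  define R where "R y = cosh a * (1 + G y) + l * (sinh a / a) * inner_d d (dev y) s" for y
  have a: "a \<ge> 0" and N: "N y \<ge> 0" for y by (simp_all add: a_def N_def)
  have pw: "cosh (norm2 d (\<lambda>i. s i + l * trunc B y i)) \<le> R y" for y
  proof (cases "N y \<le> B")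
    case True
    have tr: "trunc B y = dev y" using True by (simp add: trunc_def N_def)
    have "cosh (norm2 d (\<lambda>i. s i + l * trunc B y i))
        \<le> cosh a + sinh a / a * (l * inner_d d (dev y) s) + cosh a * (exp (l * N y) - 1 - l * N y)"
      using cosh_norm2_step[of d s "\<lambda>i. l * dev y i"] l
      unfolding tr by (simp add: a_def N_def norm2_scale inner_d_commute[of d s] inner_d_scale_left)
    also have "\<dots> \<le> cosh a + sinh a / a * (l * inner_d d (dev y) s) + cosh a * G y"
      using truncated_exp_bound[of k l "N y" B] True k_gt l B N
      by (intro add_left_mono mult_left_mono) (auto simp: G_def)
    finally show ?thesis by (simp add: R_def algebra_simps)
  next
    case False
    \<comment> \<open>Outside the ball the potential does not move, but the linear term kept in
      \<open>R\<close> may be negative; \<open>G\<close> must outweigh it.\<close>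
    have "l * (sinh a / a) * - inner_d d (dev y) s \<le> l * (sinh a / a) * (N y * a)"
      using abs_inner_d_le[of d "dev y" s] l a by (intro mult_left_mono) (auto simp: a_def N_def)
    also have "\<dots> \<le> (l * N y) * sinh a" by (cases "a = 0") auto
    also have "\<dots> \<le> G y * cosh a"
      using truncated_exp_bound[of k l "N y" B] False k_gt l B N a sinh_le_cosh_real[of a]
      by (intro mult_mono) (auto simp: G_def)
    finally have "cosh a \<le> R y" by (simp add: R_def algebra_simps)
    then show ?thesis using False by (simp add: trunc_def N_def a_def)
  qed
  have [measurable]: "N \<in> borel_measurable D" unfolding N_def by measurable
  have N2: "integrable D (\<lambda>y. (N y)\<^sup>2)" "(\<integral>y. (N y)\<^sup>2 \<partial>D) \<le> 2 * d"
    using norm_moment_sq by (auto intro!: integral_le_of_nn_integral_le simp: N_def)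
  have Nk: "integrable D (\<lambda>y. N y powr k)" "(\<integral>y. N y powr k \<partial>D) \<le> sqrt d powr k"
    using norm_moment by (auto intro!: integral_le_of_nn_integral_le simp: N_def)
  have G': "G y = exp k * l\<^sup>2 * (N y)\<^sup>2 + N y powr k * (exp (l * B) / B powr k)" for y
    using B N by (simp add: G_def powr_divide)
  have intG: "integrable D G" unfolding G' [abs_def] using N2 Nk by simp
  have "(\<integral>y. G y \<partial>D) = exp k * l\<^sup>2 * (\<integral>y. (N y)\<^sup>2 \<partial>D) + (\<integral>y. N y powr k \<partial>D) * (exp (l * B) / B powr k)"
    unfolding G' using N2 Nk by simp
  also have "\<dots> \<le> exp k * l\<^sup>2 * (2 * d) + sqrt d powr k * (exp (l * B) / B powr k)"
    using N2 Nk by (intro add_mono mult_left_mono mult_right_mono) auto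
  finally have G_le: "(\<integral>y. G y \<partial>D) \<le> exp k * l\<^sup>2 * (2 * d) + (sqrt d / B) powr k * exp (l * B)"
    using B by (simp add: powr_divide)
  have intR: "integrable D R" unfolding R_def using intG integrable_inner_dev by simp
  have "0 \<le> R y" for y using pw[of y] by (rule order_trans[rotated]) simp
  have "(\<integral>\<^sup>+ y. ennreal (cosh (norm2 d (\<lambda>i. s i + l * trunc B y i))) \<partial>D) \<le> (\<integral>\<^sup>+ y. ennreal (R y) \<partial>D)"
    by (intro nn_integral_mono ennreal_leI pw)
  also have "\<dots> = ennreal (\<integral>y. R y \<partial>D)"
    using intR \<open>\<And>y. 0 \<le> R y\<close> by (simp add: nn_integral_eq_integral)
  also have "(\<integral>y. R y \<partial>D) = cosh a * (1 + (\<integral>y. G y \<partial>D))"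
    unfolding R_def using intG integrable_inner_dev by (simp add: integral_inner_dev prob_space)
  also have "ennreal \<dots> \<le> ennreal (cosh (norm2 d s) * (1 + exp k * l\<^sup>2 * (2 * d) + (sqrt d / B) powr k * exp (l * B)))"
    using G_le by (intro ennreal_leI) (simp add: a_def)
  finally show ?thesis .
qed

text \<open>Chernoff's method with \<open>cosh\<close> in place of \<open>exp\<close>, at the price
  of the factor 2. The potential starts at \<open>cosh 0 = 1\<close> and each sample multiplies it
  by at most \<open>1 + E \<le> exp E\<close>.\<close>

lemma trunc_sum_tail:
  assumes B: "B > 0" and l: "l \<ge> 0" and J: "finite J"
  shows "(\<integral>\<^sup>+ X. ennreal (of_bool (t < norm2 d (\<lambda>i. \<Sum>j\<in>J. trunc B (X j) i))) \<partial>PiM J (\<lambda>_. D))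
    \<le> ennreal (2 * exp (- l * t + card J * (exp k * l\<^sup>2 * (2 * d) + (sqrt d / B) powr k * exp (l * B))))"
proof -
  define E where "E = exp k * l\<^sup>2 * (2 * d) + (sqrt d / B) powr k * exp (l * B)"
  have E: "E \<ge> 0" by (simp add: E_def)
  define \<Psi> where "\<Psi> n s = ennreal (cosh (norm2 d s) * (1 + E) ^ n)" for n s
  have "(\<integral>\<^sup>+ X. \<Psi> 0 (\<lambda>i. 0 + (\<Sum>j\<in>J. l * trunc B (X j) i)) \<partial>PiM J (\<lambda>_. D)) \<le> \<Psi> (0 + card J) (\<lambda>i. 0)"
  proof (rule nn_integral_iid_sum_le[OF prob_space_axioms J])
    fix n s
    have "(\<integral>\<^sup>+ y. \<Psi> n (\<lambda>i. s i + l * trunc B y i) \<partial>D)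
        = (\<integral>\<^sup>+ y. ennreal (cosh (norm2 d (\<lambda>i. s i + l * trunc B y i))) \<partial>D) * ennreal ((1 + E) ^ n)"
      unfolding \<Psi>_def by (subst nn_integral_multc[symmetric]) (auto simp: E ennreal_mult')
    also have "\<dots> \<le> ennreal (cosh (norm2 d s) * (1 + E)) * ennreal ((1 + E) ^ n)"
      using exp_step[OF B l, of s] by (intro mult_right_mono) (auto simp: E_def add.assoc)
    also have "\<dots> = \<Psi> (Suc n) s"
      using E by (subst ennreal_mult'[symmetric]) (simp_all add: \<Psi>_def mult.assoc)
    finally show "(\<integral>\<^sup>+ y. \<Psi> n (\<lambda>i. s i + l * trunc B y i) \<partial>D) \<le> \<Psi> (Suc n) s" .
  qed (auto simp: \<Psi>_def)
  then have main: "(\<integral>\<^sup>+ X. ennreal (cosh (l * norm2 d (\<lambda>i. \<Sum>j\<in>J. trunc B (X j) i))) \<partial>PiM J (\<lambda>_. D))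
      \<le> ennreal ((1 + E) ^ card J)"
    using l by (simp add: \<Psi>_def norm2_scale norm2_zero flip: sum_distrib_left)
  have "of_bool (t < x) \<le> 2 * exp (- l * t) * cosh (l * x)" for x :: real
  proof (cases "t < x")
    case True
    have "exp (l * t) \<le> exp (l * x)" using True l by (simp add: mult_left_mono)
    also have "\<dots> \<le> 2 * cosh (l * x)" by (simp add: cosh_field_def)
    finally show ?thesis using True by (simp add: exp_minus field_simps)
  qed simp
  then have "(\<integral>\<^sup>+ X. ennreal (of_bool (t < norm2 d (\<lambda>i. \<Sum>j\<in>J. trunc B (X j) i))) \<partial>PiM J (\<lambda>_. D))
     \<le> (\<integral>\<^sup>+ X. ennreal (2 * exp (- l * t)) *
          ennreal (cosh (l * norm2 d (\<lambda>i. \<Sum>j\<in>J. trunc B (X j) i))) \<partial>PiM J (\<lambda>_. D))"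
    by (intro nn_integral_mono) (simp add: ennreal_leI flip: ennreal_mult')
  also have "\<dots> \<le> ennreal (2 * exp (- l * t)) * ennreal ((1 + E) ^ card J)"
  proof (subst nn_integral_cmult)
    show "(\<lambda>X. ennreal (cosh (l * norm2 d (\<lambda>i. \<Sum>j\<in>J. trunc B (X j) i))))
        \<in> borel_measurable (PiM J (\<lambda>_. D))"
      using measurable_iid_sum[OF measurable_trunc] by measurable
  qed (intro mult_left_mono main, simp)
  also have "\<dots> \<le> ennreal (2 * exp (- l * t)) * ennreal (exp (card J * E))"
    using power_mono[OF exp_ge_add_one_self[of E], of "card J"] E
    by (intro mult_left_mono ennreal_leI) (auto simp: exp_of_nat_mult)
  also have "\<dots> = ennreal (2 * exp (- l * t + card J * E))"
    unfolding exp_add by (simp add: mult.assoc flip: ennreal_mult')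
  finally show ?thesis by (simp add: E_def)
qed

end

text \<open>The witness \<open>l \<le> y\<close> absorbs the quadratic term and \<open>l \<le> ln (1 / q)\<close> the exponential one.
  Truncating at a quarter of the deviation yields \<open>q\<^sup>2\<close>, whose square root is still of
  order \<open>q\<close> when Cauchy--Schwarz is applied.\<close>
lemma fuk_nagaev_exponent:
  fixes k h y :: real and m :: nat
  defines "q \<equiv> real m * h powr k"
  assumes k: "k > 0" and h: "h > 0" and m: "m \<ge> 1"
    and y: "y = 1 / (m * h\<^sup>2 * exp k)" and y_ge: "y \<ge> k * ln m" and q: "q < 1"
  shows "\<exists>l\<ge>0. 2 * exp (- 4 * l + m * (exp k * l\<^sup>2 * (2 * h\<^sup>2) + h powr k * exp l))
    \<le> 2 * exp 1 * (1 + k powr k * exp k powr k) * q\<^sup>2"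
proof -
  have q0: "q > 0" using h m by (simp add: q_def)
  have y0: "y > 0" using h m by (simp add: y)
  define l where "l = min y (ln (1 / q))"
  have l: "l \<ge> 0" "l \<le> y" "l \<le> ln (1 / q)" using y0 q q0 by (auto simp: l_def ln_div)
  have ql: "q * exp l \<le> 1"
  proof -
    have "exp l \<le> exp (ln (1 / q))" using l by simp
    then show ?thesis using q0 by (simp add: field_simps)
  qed
  \<comment> \<open>\<open>y\<close> is scaled so that the quadratic term costs at most
    \<open>2 * l\<close>, half of the gain \<open>4 * l\<close>.\<close>
  have "m * (exp k * l\<^sup>2 * (2 * h\<^sup>2)) = 2 * l * (l / y)"
    using h m by (simp add: y power2_eq_square)
  also have "\<dots> \<le> 2 * l * 1" using l y0 by (intro mult_left_mono) auto
  finally have "- 4 * l + m * (exp k * l\<^sup>2 * (2 * h\<^sup>2) + h powr k * exp l) \<le> 1 + (- 2 * l)"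
    using ql by (simp add: q_def algebra_simps)
  then have "exp (- 4 * l + m * (exp k * l\<^sup>2 * (2 * h\<^sup>2) + h powr k * exp l)) \<le> exp 1 * exp (- 2 * l)"
    by (subst exp_add[symmetric]) simp
  also have "exp (- 2 * l) \<le> q\<^sup>2 + exp (- 2 * y)"
  proof (cases "y \<le> ln (1 / q)")
    case True then show ?thesis by (simp add: l_def)
  next
    case False
    then have "- 2 * l = ln q + ln q" using q0 by (simp add: l_def ln_div)
    then have "exp (- 2 * l) = q\<^sup>2" using q0 by (simp only: exp_add) (simp add: power2_eq_square)
    then show ?thesis by simp
  qed
  \<comment> \<open>One factor \<open>exp (- y)\<close> is bounded by \<open>(k / y) powr k\<close>,
    the other by \<open>real m powr (- k)\<close> through \<open>y_ge\<close>. The powers of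
    \<open>m\<close> cancel, leaving a multiple of \<open>(h powr k)\<^sup>2\<close>.\<close>
  also have "exp (- 2 * y) \<le> k powr k * exp k powr k * q\<^sup>2"
  proof -
    have "k * ln (y / k) \<le> k * (y / k - 1)"
      using y0 k by (intro mult_left_mono ln_le_minus_one) auto
    also have "\<dots> \<le> y" using k by (simp add: field_simps)
    finally have 1: "exp (- y) \<le> (k / y) powr k"
      using k y0 by (simp add: powr_def ln_div algebra_simps)
    have 2: "exp (- y) \<le> real m powr (- k)"
      using y_ge m by (simp add: powr_def)
    have "exp (- 2 * y) = exp (- y) * exp (- y)" by (simp flip: exp_add)
    also have "\<dots> \<le> (k / y) powr k * real m powr (- k)"
      using 1 2 by (intro mult_mono) auto
    also have "k / y = k * exp k * (real m * h\<^sup>2)"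
      using h m by (simp add: y)
    also have "(k * exp k * (real m * h\<^sup>2)) powr k * real m powr (- k) = k powr k * exp k powr k * (h powr k)\<^sup>2"
    proof -
      have "h\<^sup>2 powr k = (h powr k)\<^sup>2" using h by (simp add: power2_eq_square powr_mult)
      then show ?thesis using k h m by (simp add: powr_mult powr_minus)
    qed
    also have "(h powr k)\<^sup>2 \<le> q\<^sup>2"
      using m h by (intro power_mono) (auto simp: q_def)
    finally show ?thesis using k by (simp add: mult_left_mono)
  qed
  finally show ?thesis using l(1)
    by (intro exI[of _ l]) (simp add: algebra_simps)
qed

section \<open>Bias of the clipped mean\<close>

text \<open>Where clipping acts, the error is \<open>x - u\<close> times a factor between 0 and 1,
  and replacing \<open>u\<close> by \<open>\<mu>\<close> costs \<open>\<epsilon>\<close>. It acts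
  only if \<open>x\<close> is farther than \<open>\<rho>\<close> from \<open>u\<close>, hence
  farther than \<open>\<rho> - \<epsilon> \<ge> \<rho> / 2\<close> from
  \<open>\<mu>\<close>.\<close>

lemma clip_error_le:
  assumes \<rho>: "\<rho> \<ge> 0" and u: "norm2 d (\<lambda>i. u i - \<mu> i) \<le> \<epsilon>" and \<epsilon>: "\<epsilon> \<le> \<rho> / 2"
    and v: "norm2 d v = 1"
  shows "\<bar>inner_d d (\<lambda>i. x i - clip d \<rho> u x i) v\<bar>
    \<le> (\<bar>inner_d d (\<lambda>i. x i - \<mu> i) v\<bar> + \<epsilon>) * of_bool (\<rho> / 2 < norm2 d (\<lambda>i. x i - \<mu> i))"
proof -
  define N where "N = norm2 d (\<lambda>i. x i - u i)"
  have u': "norm2 d (\<lambda>i. \<mu> i - u i) \<le> \<epsilon>"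
    using u norm2_scale[of d "-1" "\<lambda>i. u i - \<mu> i"] by (simp add: algebra_simps)
  then have \<epsilon>0: "\<epsilon> \<ge> 0" by (rule order_trans[OF norm2_nonneg])
  have split: "(\<lambda>i. x i - u i) = (\<lambda>i. (x i - \<mu> i) + (\<mu> i - u i))" by auto
  show ?thesis
  proof (cases "N \<le> \<rho>")
    case True
    then show ?thesis using \<epsilon>0 by (simp add: clip_def N_def inner_d_def)
  next
    case False
    have "N \<le> norm2 d (\<lambda>i. x i - \<mu> i) + \<epsilon>"
      unfolding N_def split using norm2_triangle[of d "\<lambda>i. x i - \<mu> i" "\<lambda>i. \<mu> i - u i"] u' by linarith
    then have ind: "\<rho> / 2 < norm2 d (\<lambda>i. x i - \<mu> i)" using False \<epsilon> by simp
    have "(\<lambda>i. x i - clip d \<rho> u x i) = (\<lambda>i. (1 - \<rho> / N) * (x i - u i))"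
      using False by (auto simp: clip_def N_def algebra_simps)
    then have "\<bar>inner_d d (\<lambda>i. x i - clip d \<rho> u x i) v\<bar> = \<bar>1 - \<rho> / N\<bar> * \<bar>inner_d d (\<lambda>i. x i - u i) v\<bar>"
      by (simp add: inner_d_scale_left abs_mult)
    also have "\<dots> \<le> 1 * \<bar>inner_d d (\<lambda>i. x i - u i) v\<bar>"
      using False \<rho> by (intro mult_right_mono) (auto simp: field_simps)
    also have "\<dots> \<le> \<bar>inner_d d (\<lambda>i. x i - \<mu> i) v\<bar> + \<bar>inner_d d (\<lambda>i. \<mu> i - u i) v\<bar>"
      unfolding split inner_d_add_left by simp
    also have "\<bar>inner_d d (\<lambda>i. \<mu> i - u i) v\<bar> \<le> \<epsilon>"
      using abs_inner_d_le[of d "\<lambda>i. \<mu> i - u i" v] u' v by simp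
    finally show ?thesis using ind by simp
  qed
qed

lemma abs_coord_le_norm2: "i < d \<Longrightarrow> \<bar>x i\<bar> \<le> norm2 d x"
  unfolding norm2_def using member_le_L2_set[of "{..<d}" i "\<lambda>i. \<bar>x i\<bar>"] by (simp add: L2_set_def)

section \<open>Independent samples and the expected clipping error\<close>

context moment_bound
begin

lemma distr_iid_component:
  assumes "finite J" "j \<in> J"
  shows "distr (PiM J (\<lambda>_. D)) D (\<lambda>X. X j) = D"
  using distr_PiM_component[of J "\<lambda>_. D" j] assms prob_space_axioms by simp

lemma measurable_iid_component:
  "j \<in> J \<Longrightarrow> (\<lambda>X. X j) \<in> measurable (PiM J (\<lambda>_. D)) D"
  by (rule measurable_component_singleton)

lemma nn_integral_iid_component:
  assumes "finite J" "j \<in> J" "f \<in> borel_measurable D"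
  shows "(\<integral>\<^sup>+ X. f (X j) \<partial>PiM J (\<lambda>_. D)) = (\<integral>\<^sup>+ y. f y \<partial>D)"
  using nn_integral_distr[OF measurable_iid_component[OF assms(2)], of f] distr_iid_component[OF assms(1,2)] assms
  by simp

lemma integral_iid_component:
  fixes f :: "(nat \<Rightarrow> real) \<Rightarrow> real"
  assumes "finite J" "j \<in> J" "integrable D f"
  shows "integrable (PiM J (\<lambda>_. D)) (\<lambda>X. f (X j))" "(\<integral>X. f (X j) \<partial>PiM J (\<lambda>_. D)) = (\<integral>y. f y \<partial>D)"
  using integrable_distr[OF measurable_iid_component[OF assms(2)], of f]
    integral_distr[OF measurable_iid_component[OF assms(2)], of f]
    distr_iid_component[OF assms(1,2)] assms(3)
  by auto

text \<open>Variances add: in the potential \<open>(inner_d d s v)\<^sup>2 + 2 * n\<close> the cross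
  term of each new sample integrates to zero and its square adds at most 2.\<close>

lemma second_moment_iid_sum:
  assumes J: "finite J" and v: "norm2 d v = 1"
  shows "(\<integral>\<^sup>+ X. ennreal ((\<Sum>j\<in>J. inner_d d (dev (X j)) v)\<^sup>2) \<partial>PiM J (\<lambda>_. D)) \<le> ennreal (2 * card J)"
proof -
  define \<Psi> where "\<Psi> n s = ennreal ((inner_d d s v)\<^sup>2 + 2 * real n)" for n s
  have "(\<integral>\<^sup>+ X. \<Psi> 0 (\<lambda>i. 0 + (\<Sum>j\<in>J. dev (X j) i)) \<partial>PiM J (\<lambda>_. D)) \<le> \<Psi> (0 + card J) (\<lambda>i. 0)"
  proof (rule nn_integral_iid_sum_le[OF prob_space_axioms J])
    fix n s
    define R where "R y = ((inner_d d s v)\<^sup>2 + 2 * real n) + 2 * inner_d d s v * inner_d d (dev y) v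
        + (inner_d d (dev y) v)\<^sup>2" for y
    have R: "(inner_d d (\<lambda>i. s i + dev y i) v)\<^sup>2 + 2 * real n = R y" for y
      by (simp add: R_def inner_d_add_left power2_sum)
    have R_nonneg: "0 \<le> R y" for y by (simp flip: R)
    have sq: "integrable D (\<lambda>y. (inner_d d (dev y) v)\<^sup>2)" "(\<integral>y. (inner_d d (dev y) v)\<^sup>2 \<partial>D) \<le> 2"
      using moment_sq[OF v] by (auto intro!: integral_le_of_nn_integral_le[where c = 2])
    have "(\<integral>\<^sup>+ y. \<Psi> n (\<lambda>i. s i + dev y i) \<partial>D) = (\<integral>\<^sup>+ y. ennreal (R y) \<partial>D)"
      by (simp only: \<Psi>_def R)
    also have "\<dots> = ennreal (\<integral>y. R y \<partial>D)"
      using sq(1) integrable_inner_dev R_nonneg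
      by (intro nn_integral_eq_integral) (auto simp: R_def[abs_def])
    also have "(\<integral>y. R y \<partial>D) \<le> (inner_d d s v)\<^sup>2 + 2 * real (Suc n)"
      unfolding R_def using sq integrable_inner_dev by (simp add: integral_inner_dev prob_space)
    finally show "(\<integral>\<^sup>+ y. \<Psi> n (\<lambda>i. s i + dev y i) \<partial>D) \<le> \<Psi> (Suc n) s"
      by (simp add: \<Psi>_def ennreal_leI)
  qed (auto simp: \<Psi>_def)
  then show ?thesis
    by (simp add: \<Psi>_def inner_d_sum_left) (simp add: inner_d_def)
qed

text \<open>The sum omits sample \<open>j\<close>, so Fubini turns the expectation into the product
  of a tail probability and a second moment.\<close>

lemma tail_times_rest:
  assumes J: "finite J" "j \<notin> J" and B: "B > 0" and v: "norm2 d v = 1"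
  shows "(\<integral>\<^sup>+ X. ennreal (of_bool (B < norm2 d (dev (X j))) * (\<Sum>i\<in>J. inner_d d (dev (X i)) v)\<^sup>2)
      \<partial>PiM (insert j J) (\<lambda>_. D)) \<le> ennreal ((sqrt d / B) powr k * (2 * card J))"
proof -
  interpret product_sigma_finite "\<lambda>_::'b. D"
    by (simp add: product_sigma_finite_def prob_space_imp_sigma_finite prob_space_axioms)
  have cmp: "(\<lambda>X. inner_d d (dev (X i)) v) \<in> borel_measurable (PiM K (\<lambda>_. D))" if "i \<in> K" for i K
    by (rule measurable_compose[OF measurable_iid_component[OF that], of "\<lambda>y. inner_d d (dev y) v"]) simp
  have S: "(\<lambda>X. \<Sum>i\<in>J. inner_d d (dev (X i)) v) \<in> borel_measurable (PiM K (\<lambda>_. D))" if "J \<subseteq> K" for K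
    using that by (intro borel_measurable_sum cmp) auto
  have [measurable]: "(\<lambda>X. of_bool (B < norm2 d (dev (X j))) :: real) \<in> borel_measurable (PiM (insert j J) (\<lambda>_. D))"
    by (rule measurable_compose[OF measurable_iid_component, of j _ "\<lambda>y. of_bool (B < norm2 d (dev y)) :: real"]) auto
  have "(\<integral>\<^sup>+ X. ennreal (of_bool (B < norm2 d (dev (X j))) * (\<Sum>i\<in>J. inner_d d (dev (X i)) v)\<^sup>2)
      \<partial>PiM (insert j J) (\<lambda>_. D))
    = (\<integral>\<^sup>+ X. \<integral>\<^sup>+ y. ennreal (of_bool (B < norm2 d (dev ((X(j := y)) j)))
         * (\<Sum>i\<in>J. inner_d d (dev ((X(j := y)) i)) v)\<^sup>2) \<partial>D \<partial>PiM J (\<lambda>_. D))"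
    using S[of "insert j J"] by (intro product_nn_integral_insert J) auto
  also have "\<dots> = (\<integral>\<^sup>+ X. \<integral>\<^sup>+ y. ennreal (of_bool (B < norm2 d (dev y)))
         * ennreal ((\<Sum>i\<in>J. inner_d d (dev (X i)) v)\<^sup>2) \<partial>D \<partial>PiM J (\<lambda>_. D))"
  proof -
    have "(\<Sum>i\<in>J. inner_d d (dev ((X(j := y)) i)) v) = (\<Sum>i\<in>J. inner_d d (dev (X i)) v)" for X y
      using J by (intro sum.cong) auto
    then show ?thesis by (simp only: ennreal_mult' of_bool_def fun_upd_same) (simp add: ennreal_mult')
  qed
  also have "\<dots> = (\<integral>\<^sup>+ y. ennreal (of_bool (B < norm2 d (dev y))) \<partial>D)
      * (\<integral>\<^sup>+ X. ennreal ((\<Sum>i\<in>J. inner_d d (dev (X i)) v)\<^sup>2) \<partial>PiM J (\<lambda>_. D))"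
    using S[of J] by (simp add: nn_integral_multc nn_integral_cmult)
  also have "\<dots> \<le> ennreal ((sqrt d / B) powr k) * ennreal (2 * card J)"
    by (intro mult_mono tail_norm second_moment_iid_sum J B v) auto
  finally show ?thesis by (simp flip: ennreal_mult')
qed

text \<open>Testing the bias against its own direction reduces it to one-dimensional expectations.\<close>
lemma bias_le:
  assumes m: "m \<ge> 1" and \<rho>: "\<rho> \<ge> 0" and c: "c \<ge> 0"
    and dir: "\<And>v. norm2 d v = 1 \<Longrightarrow>
      (\<integral>\<^sup>+ X. ennreal \<bar>inner_d d (\<lambda>i. sample_mean m X i - clip d \<rho> u (sample_mean m X) i) v\<bar>
        \<partial>iid_sample m D) \<le> ennreal c"
  shows "norm2 d (\<lambda>i. \<mu> i - vec_expectation (iid_sample m D) (\<lambda>X. clip d \<rho> u (sample_mean m X)) i) \<le> c"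
proof -
  let ?M = "PiM {..<m} (\<lambda>_. D)"
  interpret M: prob_space ?M by (rule prob_space_PiM[OF prob_space_axioms])
  define w where "w = (\<lambda>i. \<mu> i - vec_expectation (iid_sample m D) (\<lambda>X. clip d \<rho> u (sample_mean m X)) i)"
  define e where "e X = (\<lambda>i. sample_mean m X i - clip d \<rho> u (sample_mean m X) i)" for X
  have sm [measurable]: "(\<lambda>X. sample_mean m X i) \<in> borel_measurable ?M" for i
    unfolding sample_mean_def using measurable_iid_sum[OF measurable_coord] by measurable
  have cl [measurable]: "(\<lambda>X. clip d \<rho> u (sample_mean m X) i) \<in> borel_measurable ?M" for i
  proof -
    have "clip d \<rho> u x i = (if norm2 d (\<lambda>i. x i - u i) \<le> \<rho> then x i
        else u i + \<rho> * ((x i - u i) / norm2 d (\<lambda>i. x i - u i)))" for x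
      by (simp add: clip_def)
    then show ?thesis by simp
  qed
  have intm: "integrable ?M (\<lambda>X. sample_mean m X i)" "(\<integral>X. sample_mean m X i \<partial>?M) = \<mu> i" if "i < d" for i
  proof -
    have "integrable ?M (\<lambda>X. X j i)" "(\<integral>X. X j i \<partial>?M) = \<mu> i" if "j < m" for j
      using integral_iid_component[of "{..<m}" j "\<lambda>y. y i"] that \<open>i < d\<close>
      by (auto simp: integrable_coord integral_coord)
    then show "(\<integral>X. sample_mean m X i \<partial>?M) = \<mu> i"
      and "integrable ?M (\<lambda>X. sample_mean m X i)"
      unfolding sample_mean_def using m
      by (simp, intro integrable_mult_right Bochner_Integration.integrable_sum) simp
  qed
  have intc: "integrable ?M (\<lambda>X. clip d \<rho> u (sample_mean m X) i)" if "i < d" for i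
  proof (rule M.integrable_const_bound)
    have "\<bar>clip d \<rho> u x i\<bar> \<le> \<bar>u i\<bar> + \<rho>" for x
    proof (cases "norm2 d (\<lambda>i. x i - u i) \<le> \<rho>")
      case True
      then show ?thesis using abs_coord_le_norm2[OF that, of "\<lambda>i. x i - u i"] by (simp add: clip_def)
    next
      case False
      define N where "N = norm2 d (\<lambda>i. x i - u i)"
      have "\<bar>x i - u i\<bar> \<le> N" using abs_coord_le_norm2[OF that, of "\<lambda>i. x i - u i"] by (simp add: N_def)
      then have "\<bar>\<rho> * ((x i - u i) / N)\<bar> \<le> \<rho> * 1"
        unfolding abs_mult using False \<rho> by (intro mult_mono) (auto simp: N_def[symmetric] field_simps)
      moreover have "clip d \<rho> u x i = u i + \<rho> * ((x i - u i) / N)"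
        using False by (simp add: clip_def N_def)
      ultimately show ?thesis by linarith
    qed
    then show "AE X in ?M. norm (clip d \<rho> u (sample_mean m X) i) \<le> \<bar>u i\<bar> + \<rho>" by simp
  qed simp
  have inte: "integrable ?M (\<lambda>X. e X i)" "(\<integral>X. e X i \<partial>?M) = w i" if "i < d" for i
    unfolding e_def w_def using intm intc that by (auto simp: vec_expectation_def iid_sample_def)
  show ?thesis
  proof (cases "norm2 d w = 0")
    case True then show ?thesis using c by (simp add: w_def)
  next
    case False
    define N where "N = norm2 d w"
    have N: "N > 0" using False norm2_nonneg[of d w] by (simp add: N_def less_le)
    define v where "v = (\<lambda>i. (1 / N) * w i)"
    have v: "norm2 d v = 1" using N by (simp only: v_def norm2_scale) (simp add: N_def)
    have int: "integrable ?M (\<lambda>X. inner_d d (e X) v)"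
      unfolding inner_d_def using inte by auto
    have "N = inner_d d w v"
      using N unfolding v_def inner_d_commute[of d w] inner_d_scale_left inner_d_self
      by (simp add: N_def power2_eq_square)
    also have "\<dots> = (\<integral>X. inner_d d (e X) v \<partial>?M)"
      unfolding inner_d_def using inte by simp
    also have "\<dots> \<le> (\<integral>X. \<bar>inner_d d (e X) v\<bar> \<partial>?M)"
      using int by (intro integral_mono) auto
    finally have "ennreal N \<le> (\<integral>\<^sup>+ X. ennreal \<bar>inner_d d (e X) v\<bar> \<partial>?M)"
      using int by (subst nn_integral_eq_integral) (auto intro: ennreal_leI)
    also have "\<dots> \<le> ennreal c" using dir[OF v] by (simp add: e_def iid_sample_def)
    finally show ?thesis using c by (simp add: N_def w_def)
  qed
qed

text \<open>Both bounds are needed later: \<open>q\<^sup>2\<close> after division by the AM-GM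
  weight, \<open>q\<close> next to the constant shift. For \<open>q \<ge> 1\<close> the trivial
  bound 1 on a probability suffices.\<close>

lemma trunc_sum_tail_quadratic:
  fixes m :: nat and B h q :: real
  defines "h \<equiv> sqrt d / B"
  defines "q \<equiv> m * h powr k"
  assumes m: "m \<ge> 1" and B: "B > 0" and y: "k * ln m \<le> 1 / (m * h\<^sup>2 * exp k)"
  shows "(\<integral>\<^sup>+ X. ennreal (of_bool (4 * B < norm2 d (\<lambda>i. \<Sum>j<m. trunc B (X j) i))) \<partial>PiM {..<m} (\<lambda>_. D))
    \<le> ennreal (2 * exp 1 * (1 + k powr k * exp k powr k) * min q (q\<^sup>2))" (is "?P \<le> ennreal (?C * _)")
proof (cases "q < 1")
  case True
  have h: "h > 0" using B d_ge by (simp add: h_def)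
  have q: "q \<ge> 0" by (simp add: q_def)
  obtain l where l: "l \<ge> 0"
    and le: "2 * exp (- 4 * l + m * (exp k * l\<^sup>2 * (2 * h\<^sup>2) + h powr k * exp l)) \<le> ?C * q\<^sup>2"
    using fuk_nagaev_exponent[OF _ h m refl y] True k_gt unfolding q_def by auto
  \<comment> \<open>The Chernoff parameter is \<open>l / B\<close>, which makes the exponent depend
    on \<open>d\<close> and \<open>B\<close> only through \<open>h\<close>.\<close>
  have eq: "- (l / B) * (4 * B) + card {..<m} * (exp k * (l / B)\<^sup>2 * (2 * d) + (sqrt d / B) powr k * exp (l / B * B))
      = - 4 * l + m * (exp k * l\<^sup>2 * (2 * h\<^sup>2) + h powr k * exp l)"
    using B by (simp add: h_def power_divide)
  have "?P \<le> ennreal (2 * exp (- 4 * l + m * (exp k * l\<^sup>2 * (2 * h\<^sup>2) + h powr k * exp l)))"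
    using trunc_sum_tail[OF B, of "l / B" "{..<m}" "4 * B"] l B unfolding eq by simp
  also have "\<dots> \<le> ennreal (?C * q\<^sup>2)" by (rule ennreal_leI[OF le])
  also have "q\<^sup>2 = min q (q\<^sup>2)"
    using True q by (simp add: power2_eq_square mult_left_le min_absorb2)
  finally show ?thesis .
next
  case False
  interpret M: prob_space "PiM {..<m} (\<lambda>_. D)" by (rule prob_space_PiM[OF prob_space_axioms])
  have "?P \<le> (\<integral>\<^sup>+ X. 1 \<partial>PiM {..<m} (\<lambda>_. D))"
    by (intro nn_integral_mono) (auto simp: of_bool_def)
  also have "\<dots> = ennreal (1 * 1)" by (simp add: M.emeasure_space_1)
  also have "\<dots> \<le> ennreal (?C * min q (q\<^sup>2))"
  proof (intro ennreal_leI mult_mono)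
    have "1 * 1 * 1 \<le> ?C" by (intro mult_mono) auto
    then show "1 \<le> ?C" by simp
    show "1 \<le> min q (q\<^sup>2)" using False by simp
  qed auto
  finally show ?thesis .
qed

text \<open>For \<open>m = 1\<close> the lower bound on \<open>\<rho>\<close> is vacuous since
  \<open>ln 1 = 0\<close>, and \<open>h\<close> may be large. Markov's inequality alone is enough:
  the shift equals \<open>4 / h\<close> and has weight at most \<open>h powr k\<close>.\<close>

lemma clip_expectation_one_sample:
  fixes \<rho> B h :: real
  defines "B \<equiv> \<rho> / 8"
  defines "h \<equiv> sqrt d / B"
  assumes \<rho>: "\<rho> > 0" and v: "norm2 d v = 1"
  shows "(\<integral>\<^sup>+ y. ennreal ((\<bar>inner_d d (dev y) v\<bar> + \<rho> / (2 * sqrt d)) * of_bool (\<rho> / 2 < norm2 d (dev y))) \<partial>D)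
    \<le> ennreal (6 * h powr (k - 1))"
proof -
  have B: "B > 0" and h: "h > 0" using \<rho> d_ge by (simp_all add: B_def h_def)
  have c: "\<rho> / (2 * sqrt d) = 4 / h" using \<rho> d_ge by (simp add: h_def B_def)
  have "(\<integral>\<^sup>+ y. ennreal ((\<bar>inner_d d (dev y) v\<bar> + \<rho> / (2 * sqrt d)) * of_bool (\<rho> / 2 < norm2 d (dev y))) \<partial>D)
    \<le> (\<integral>\<^sup>+ y. ennreal (\<bar>inner_d d (dev y) v\<bar> * of_bool (B < norm2 d (dev y)))
        + ennreal (4 / h) * ennreal (of_bool (B < norm2 d (dev y))) \<partial>D)"
    using \<rho> h unfolding c by (intro nn_integral_mono) (auto simp: B_def)
  also have "\<dots> = (\<integral>\<^sup>+ y. ennreal (\<bar>inner_d d (dev y) v\<bar> * of_bool (B < norm2 d (dev y))) \<partial>D)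
        + ennreal (4 / h) * (\<integral>\<^sup>+ y. ennreal (of_bool (B < norm2 d (dev y))) \<partial>D)"
    by (simp add: nn_integral_add nn_integral_cmult)
  also have "\<dots> \<le> ennreal (2 * h powr (k - 1)) + ennreal (4 / h) * ennreal (h powr k)"
    unfolding h_def by (intro add_mono mult_left_mono inner_on_tail tail_norm B v) simp
  also have "\<dots> = ennreal (2 * h powr (k - 1) + (4 / h) * h powr k)"
    using h by (simp flip: ennreal_mult' ennreal_plus)
  also have "(4 / h) * h powr k = 4 * h powr (k - 1)" using h by (simp add: powr_diff)
  finally show ?thesis by simp
qed

text \<open>Either one sample is large, and then the remaining ones are independent of it, or the
  truncated sum is large; the Cauchy--Schwarz steps are replaced by weighted AM--GM.\<close>
lemma clip_expectation_many_samples: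
  fixes \<rho> B h C :: real and m :: nat
  defines "B \<equiv> m * \<rho> / 8"
  defines "h \<equiv> sqrt d / B"
  defines "C \<equiv> 2 * exp 1 * (1 + k powr k * exp k powr k)"
  assumes \<rho>: "\<rho> > 0" and v: "norm2 d v = 1" and m: "m \<ge> 2"
    and y: "k * ln m \<le> 1 / (m * h\<^sup>2 * exp k)"
  shows "(\<integral>\<^sup>+ X. ennreal ((\<bar>\<Sum>j<m. inner_d d (dev (X j)) v\<bar> / m + \<rho> / (2 * sqrt d))
      * of_bool (4 * B < norm2 d (\<lambda>i. \<Sum>j<m. dev (X j) i))) \<partial>PiM {..<m} (\<lambda>_. D))
    \<le> ennreal ((11 + 5 * C) * h powr (k - 1))"
proof -
  let ?M = "PiM {..<m} (\<lambda>_. D)"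
  interpret M: prob_space ?M by (rule prob_space_PiM[OF prob_space_axioms])
  have B: "B > 0" and h: "h > 0" using \<rho> d_ge m by (simp_all add: B_def h_def)
  \<comment> \<open>The weight \<open>1 / s\<close> balances \<open>r\<^sup>2 / s\<close> against
    \<open>s\<close>, because the sum of the other samples has second moment at most
    \<open>2 * m\<close>.\<close>
  define s where "s = sqrt m"
  have s: "s > 0" "s * s = m" using m by (auto simp: s_def)
  define c where "c = \<rho> / (2 * sqrt d)"
  have c: "c * m = 4 / h" "c > 0" using \<rho> d_ge m by (simp_all add: h_def B_def c_def)
  have C: "C \<ge> 0" by (simp add: C_def)
  \<comment> \<open>Chosen so that \<open>\<eta> * (2 * m)\<close> and
    \<open>C * q\<^sup>2 / \<eta>\<close>, divided by \<open>m\<close>, are both multiples of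
    \<open>s * h powr k\<close>.\<close>
  define \<eta> where "\<eta> = h powr k * s"
  have \<eta>: "\<eta> > 0" using h s by (simp add: \<eta>_def)
  define q where "q = m * h powr k"

  define a where "a j X = inner_d d (dev (X j)) v" for j and X :: "nat \<Rightarrow> nat \<Rightarrow> real"
  define b where "b j X = (of_bool (B < norm2 d (dev (X j))) :: real)" for j and X :: "nat \<Rightarrow> nat \<Rightarrow> real"
  define r where "r j X = (\<Sum>i\<in>{..<m} - {j}. a i X)" for j X
  define e where "e X = (of_bool (4 * B < norm2 d (\<lambda>i. \<Sum>j<m. trunc B (X j) i)) :: real)" for X
  define S where "S X = (\<Sum>j<m. a j X)" for X

  have [measurable]: "a j \<in> borel_measurable ?M" "b j \<in> borel_measurable ?M" if "j < m" for j
    unfolding a_def b_def using that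
    by (auto intro!: measurable_compose[OF measurable_iid_component, of j _ "\<lambda>y. inner_d d (dev y) v"]
        measurable_compose[OF measurable_iid_component, of j _ "\<lambda>y. of_bool (B < norm2 d (dev y)) :: real"])
  have [measurable]: "r j \<in> borel_measurable ?M" "S \<in> borel_measurable ?M" for j
    unfolding r_def S_def by measurable
  have [measurable]: "e \<in> borel_measurable ?M"
    unfolding e_def using measurable_iid_sum[OF measurable_trunc] by measurable

  have "integrable ?M (\<lambda>X. \<bar>a j X\<bar> * b j X)" "(\<integral>X. \<bar>a j X\<bar> * b j X \<partial>?M) \<le> 2 * h powr (k - 1)"
    if "j < m" for j
    using inner_on_tail[OF B v] that
      nn_integral_iid_component[of "{..<m}" j "\<lambda>y. ennreal (\<bar>inner_d d (dev y) v\<bar> * of_bool (B < norm2 d (dev y)))"]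
    by (auto intro!: M.integral_le_of_nn_integral_le simp: a_def b_def h_def)
  note ab = this
  have "integrable ?M (b j)" "(\<integral>X. b j X \<partial>?M) \<le> h powr k" if "j < m" for j
    using tail_norm[OF B] that
      nn_integral_iid_component[of "{..<m}" j "\<lambda>y. ennreal (of_bool (B < norm2 d (dev y)))"]
    by (auto intro!: M.integral_le_of_nn_integral_le simp: b_def h_def)
  note b = this
  have "integrable ?M (\<lambda>X. b j X * (r j X)\<^sup>2)" "(\<integral>X. b j X * (r j X)\<^sup>2 \<partial>?M) \<le> h powr k * (2 * m)"
    if "j < m" for j
  proof -
    have ins: "insert j ({..<m} - {j}) = {..<m}" using that by auto
    have "(\<integral>\<^sup>+ X. ennreal (b j X * (r j X)\<^sup>2) \<partial>?M) \<le> ennreal (h powr k * (2 * real (card ({..<m} - {j}))))"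
      using tail_times_rest[of "{..<m} - {j}" j B v] B v
      unfolding ins by (simp add: a_def b_def r_def h_def)
    also have "\<dots> \<le> ennreal (h powr k * (2 * m))"
      using that by (intro ennreal_leI mult_left_mono) auto
    finally show "integrable ?M (\<lambda>X. b j X * (r j X)\<^sup>2)" "(\<integral>X. b j X * (r j X)\<^sup>2 \<partial>?M) \<le> h powr k * (2 * m)"
      using that by (auto intro!: M.integral_le_of_nn_integral_le simp: b_def[of j])
  qed
  note br = this
  have S2: "integrable ?M (\<lambda>X. (S X)\<^sup>2)" "(\<integral>X. (S X)\<^sup>2 \<partial>?M) \<le> 2 * m"
    using second_moment_iid_sum[OF _ v, of "{..<m}"]
    by (auto intro!: M.integral_le_of_nn_integral_le simp: S_def a_def)
  have e: "integrable ?M e" "(\<integral>X. e X \<partial>?M) \<le> C * min q (q\<^sup>2)"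
    using trunc_sum_tail_quadratic[of m B] m B y C
    by (auto intro!: M.integral_le_of_nn_integral_le simp: e_def C_def q_def h_def)

  \<comment> \<open>The sum over \<open>j\<close> pays for a large sample \<open>j\<close>, the
    remaining terms for a large truncated sum. All are nonnegative, so each case below needs only
    its own part.\<close>
  define R where "R X = (\<Sum>j<m. (\<bar>a j X\<bar> * b j X + b j X * (r j X)\<^sup>2 / s + s * b j X) / m + c * b j X)
      + (\<eta> * (S X)\<^sup>2 + e X / \<eta>) / m + c * e X" for X
  have amgm: "\<bar>x\<bar> \<le> w * x\<^sup>2 + 1 / w" if "w > 0" for x w :: real
  proof (cases "\<bar>x\<bar> \<le> 1 / w")
    case True then show ?thesis using that by (simp add: add_increasing)
  next
    case False
    then have "1 * \<bar>x\<bar> \<le> (w * \<bar>x\<bar>) * \<bar>x\<bar>"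
      using that by (intro mult_right_mono) (auto simp: field_simps)
    also have "(w * \<bar>x\<bar>) * \<bar>x\<bar> = w * x\<^sup>2" by (simp add: power2_eq_square)
    finally show ?thesis using that by (simp add: add_increasing2)
  qed
  have termj: "0 \<le> (\<bar>a j X\<bar> * b j X + b j X * (r j X)\<^sup>2 / s + s * b j X) / m + c * b j X" for j X
    using s c by (simp add: b_def)
  have rest: "0 \<le> (\<eta> * (S X)\<^sup>2 + e X / \<eta>) / m + c * e X" for X
    using \<eta> c by (simp add: e_def)
  have pw: "(\<bar>\<Sum>j<m. inner_d d (dev (X j)) v\<bar> / m + \<rho> / (2 * sqrt d))
      * of_bool (4 * B < norm2 d (\<lambda>i. \<Sum>j<m. dev (X j) i)) \<le> R X" for X
  proof -
    consider "norm2 d (\<lambda>i. \<Sum>j<m. dev (X j) i) \<le> 4 * B"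
      | j where "j < m" "B < norm2 d (dev (X j))"
      | "\<And>j. j < m \<Longrightarrow> norm2 d (dev (X j)) \<le> B" "4 * B < norm2 d (\<lambda>i. \<Sum>j<m. dev (X j) i)"
      by force
    then show ?thesis
    proof cases
      case 1
      then show ?thesis
        unfolding R_def using sum_nonneg[of "{..<m}", OF termj] rest[of X] by (simp add: add.assoc)
    next
      case (2 j)
      then have bj: "b j X = 1" by (simp add: b_def)
      have "S X = a j X + r j X" unfolding S_def r_def using 2 by (simp add: sum.remove)
      then have "\<bar>S X\<bar> \<le> \<bar>a j X\<bar> + (1 / s * (r j X)\<^sup>2 + 1 / (1 / s))"
        using amgm[of "1 / s" "r j X"] s(1) abs_triangle_ineq[of "a j X" "r j X"] by simp
      then have "\<bar>S X\<bar> / m + c \<le> (\<bar>a j X\<bar> * b j X + b j X * (r j X)\<^sup>2 / s + s * b j X) / m + c * b j X"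
        using m by (simp add: bj divide_right_mono)
      also have "\<dots> \<le> (\<Sum>j<m. (\<bar>a j X\<bar> * b j X + b j X * (r j X)\<^sup>2 / s + s * b j X) / m + c * b j X)"
        using 2 by (intro member_le_sum) (auto simp: termj)
      also have "\<dots> \<le> R X" unfolding R_def using rest[of X] by linarith
      finally have "\<bar>S X\<bar> / m + c \<le> R X" .
      moreover have "(\<bar>S X\<bar> / m + c) * of_bool P \<le> \<bar>S X\<bar> / m + c" for P
        using c by (cases P) (auto intro: add_nonneg_nonneg)
      ultimately show ?thesis unfolding S_def a_def c_def by (rule order_trans[rotated])
    next
      case 3
      have "(\<lambda>i. \<Sum>j<m. trunc B (X j) i) = (\<lambda>i. \<Sum>j<m. dev (X j) i)"
        using 3 by (simp add: trunc_def)
      then have eX: "e X = 1" using 3 by (simp add: e_def)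
      have "\<bar>S X\<bar> / m + c \<le> (\<eta> * (S X)\<^sup>2 + e X / \<eta>) / m + c * e X"
        using amgm[OF \<eta>, of "S X"] by (simp add: eX divide_right_mono)
      also have "\<dots> \<le> R X"
        unfolding R_def using sum_nonneg[of "{..<m}", OF termj] by simp
      finally show ?thesis using 3 by (simp add: S_def a_def c_def)
    qed
  qed
  have R0: "0 \<le> R X" for X
    unfolding R_def using sum_nonneg[of "{..<m}", OF termj] rest[of X] by (simp add: add.assoc)
  have "has_bochner_integral ?M R ((\<Sum>j<m. ((\<integral>X. \<bar>a j X\<bar> * b j X \<partial>?M) + (\<integral>X. b j X * (r j X)\<^sup>2 \<partial>?M) / s
        + s * (\<integral>X. b j X \<partial>?M)) / m + c * (\<integral>X. b j X \<partial>?M))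
      + (\<eta> * (\<integral>X. (S X)\<^sup>2 \<partial>?M) + (\<integral>X. e X \<partial>?M) / \<eta>) / m + c * (\<integral>X. e X \<partial>?M))"
    unfolding R_def using ab b br S2 e
    by (intro has_bochner_integral_add has_bochner_integral_sum has_bochner_integral_divide_zero
        has_bochner_integral_mult_right has_bochner_integral_integrable) auto
  then have intR: "integrable ?M R" and valR: "(\<integral>X. R X \<partial>?M) = (\<Sum>j<m. ((\<integral>X. \<bar>a j X\<bar> * b j X \<partial>?M) + (\<integral>X. b j X * (r j X)\<^sup>2 \<partial>?M) / s
        + s * (\<integral>X. b j X \<partial>?M)) / m + c * (\<integral>X. b j X \<partial>?M))
      + (\<eta> * (\<integral>X. (S X)\<^sup>2 \<partial>?M) + (\<integral>X. e X \<partial>?M) / \<eta>) / m + c * (\<integral>X. e X \<partial>?M)"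
    by (auto simp: has_bochner_integral_iff)
  have "(\<integral>\<^sup>+ X. ennreal ((\<bar>\<Sum>j<m. inner_d d (dev (X j)) v\<bar> / m + \<rho> / (2 * sqrt d))
      * of_bool (4 * B < norm2 d (\<lambda>i. \<Sum>j<m. dev (X j) i))) \<partial>?M) \<le> (\<integral>\<^sup>+ X. ennreal (R X) \<partial>?M)"
    by (intro nn_integral_mono ennreal_leI pw)
  also have "\<dots> = ennreal (\<integral>X. R X \<partial>?M)"
    using intR R0 by (intro nn_integral_eq_integral) auto
  also have "(\<integral>X. R X \<partial>?M) \<le> (\<Sum>j<m. (2 * h powr (k - 1) + h powr k * (2 * m) / s + s * h powr k) / m + c * h powr k)
      + (\<eta> * (2 * m) + C * q\<^sup>2 / \<eta>) / m + c * (C * q)"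
    unfolding valR
  proof (intro add_mono sum_mono divide_right_mono mult_left_mono)
    show "(\<integral>X. e X \<partial>?M) \<le> C * q\<^sup>2" "(\<integral>X. e X \<partial>?M) \<le> C * q"
      by (intro order_trans[OF e(2)] mult_left_mono C min.cobounded1 min.cobounded2)+
  qed (use ab b br S2 s \<eta> c in auto)
  also have "\<dots> = 2 * h powr (k - 1) + (5 + C) * (s * h powr k) + (1 + C) * (c * m) * h powr k"
  proof -
    have m': "real m = s * s" using s by simp
    have eq1: "(\<Sum>j<m. (2 * h powr (k - 1) + h powr k * (2 * m) / s + s * h powr k) / m + c * h powr k)
        = 2 * h powr (k - 1) + h powr k * (2 * m) / s + s * h powr k + m * (c * h powr k)"
      using m by (simp add: distrib_left add_divide_distrib)
    have eq2: "h powr k * (2 * m) / s = 2 * (s * h powr k)" using s(1) by (simp add: m')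
    have eq3: "(\<eta> * (2 * m) + C * q\<^sup>2 / \<eta>) / m = 2 * (s * h powr k) + C * (s * h powr k)"
      using s(1) h by (simp add: m' \<eta>_def q_def power2_eq_square field_simps)
    show ?thesis unfolding eq1 unfolding eq2 eq3 by (simp add: q_def algebra_simps)
  qed
  also have "\<dots> \<le> 2 * h powr (k - 1) + (5 + C) * h powr (k - 1) + (1 + C) * (4 * h powr (k - 1))"
  proof (intro add_mono mult_left_mono order_refl)
    \<comment> \<open>As \<open>m \<ge> 2\<close>, \<open>k * ln m\<close> exceeds 1, so
      \<open>y\<close> forces \<open>s * h \<le> 1\<close>; this turns \<open>s * h powr k\<close>
      into \<open>h powr (k - 1)\<close>.\<close>
    have "2 / 3 \<le> ln (2::real)" by (rule ln2_ge_two_thirds)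
    also have "ln 2 \<le> ln (real m)" using m by simp
    finally have "2 * (2 / 3) \<le> k * ln m" using k_gt by (intro mult_mono) auto
    then have "1 \<le> 1 / (m * h\<^sup>2 * exp k)" using y by simp
    then have "(s * h)\<^sup>2 * exp k \<le> 1"
      using h m s by (simp add: field_simps power2_eq_square)
    moreover have "(s * h)\<^sup>2 * 1 \<le> (s * h)\<^sup>2 * exp k" using k_gt by (intro mult_left_mono) auto
    ultimately have "(s * h)\<^sup>2 \<le> 1" by simp
    then have "s * h \<le> 1" using power2_le_imp_le[of "s * h" 1] by simp
    then have "(s * h) * h powr (k - 1) \<le> 1 * h powr (k - 1)" by (intro mult_right_mono) auto
    then show "s * h powr k \<le> h powr (k - 1)" using h by (simp add: powr_diff)
    show "(1 + C) * (c * m) * h powr k \<le> (1 + C) * (4 * h powr (k - 1))"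
      using h unfolding c by (simp add: powr_diff ring_distribs add_divide_distrib mult.assoc)
  qed (use C in auto)
  also have "\<dots> = (11 + 5 * C) * h powr (k - 1)" by (simp add: algebra_simps)
  finally show ?thesis by (simp add: ennreal_leI)
qed

lemma clip_bias:
  fixes \<rho> C :: real and m :: nat
  defines "C \<equiv> 2 * exp 1 * (1 + k powr k * exp k powr k)"
  assumes \<rho>: "\<rho> > 0" and m: "m \<ge> 1"
    and \<rho>_ge: "sqrt (64 * k * exp k) * sqrt (real d * ln m / m) \<le> \<rho>"
    and u: "norm2 d (\<lambda>i. u i - \<mu> i) \<le> \<rho> / (2 * sqrt d)"
  shows "norm2 d (\<lambda>i. \<mu> i - vec_expectation (iid_sample m D) (\<lambda>X. clip d \<rho> u (sample_mean m X)) i)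
    \<le> (11 + 5 * C) * 8 powr (k - 1) * (sqrt d / (m * \<rho>)) powr (k - 1)"
proof -
  define B where "B = m * \<rho> / 8"
  define h where "h = sqrt d / B"
  have h: "h > 0" using \<rho> m d_ge by (simp add: h_def B_def)
  have C: "C \<ge> 0" by (simp add: C_def)
  \<comment> \<open>Squaring the lower bound on \<open>\<rho>\<close> gives precisely the condition
    \<open>y\<close>: the 64 cancels the one in \<open>h\<^sup>2\<close>, which comes from
    \<open>B = m * \<rho> / 8\<close>.\<close>
  have "(sqrt (64 * k * exp k) * sqrt (real d * ln m / m))\<^sup>2 \<le> \<rho>\<^sup>2"
    using \<rho>_ge m k_gt by (intro power_mono) auto
  then have "64 * k * exp k * (real d * ln m / m) \<le> \<rho>\<^sup>2"
    using m k_gt by (simp add: power_mult_distrib)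
  moreover have h2: "h\<^sup>2 = 64 * d / (m * \<rho>)\<^sup>2"
    by (simp add: h_def B_def power_divide power_mult_distrib)
  ultimately have y: "k * ln m \<le> 1 / (m * h\<^sup>2 * exp k)"
    unfolding h2 using m d_ge \<rho> by (simp add: power2_eq_square field_simps)
  have "1 \<le> sqrt d" using d_ge by simp
  then have \<epsilon>: "\<rho> / (2 * sqrt d) \<le> \<rho> / 2" using \<rho> by (intro divide_left_mono) auto
  have mean_dev: "(\<lambda>i. sample_mean m X i - \<mu> i) = (\<lambda>i. (1 / m) * (\<Sum>j<m. dev (X j) i))" for X
    using m by (simp add: sample_mean_def dev_def sum_subtractf field_simps)
  have pw: "\<bar>inner_d d (\<lambda>i. sample_mean m X i - clip d \<rho> u (sample_mean m X) i) v\<bar>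
      \<le> (\<bar>\<Sum>j<m. inner_d d (dev (X j)) v\<bar> / m + \<rho> / (2 * sqrt d))
        * of_bool (4 * B < norm2 d (\<lambda>i. \<Sum>j<m. dev (X j) i))" if "norm2 d v = 1" for X v
  proof -
    \<comment> \<open>Distance \<open>\<rho> / 2\<close> for the sample mean is
      \<open>m * \<rho> / 2 = 4 * B\<close> for the sum.\<close>
    have "(\<rho> / 2 < 1 / m * N) = (4 * B < N)" for N
      using m by (simp add: B_def field_simps)
    then show ?thesis
      using clip_error_le[OF less_imp_le[OF \<rho>] u \<epsilon> that, of "sample_mean m X"] m
      unfolding mean_dev norm2_scale inner_d_scale_left inner_d_sum_left by (simp add: abs_mult)
  qed
  have "norm2 d (\<lambda>i. \<mu> i - vec_expectation (iid_sample m D) (\<lambda>X. clip d \<rho> u (sample_mean m X)) i)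
      \<le> (11 + 5 * C) * h powr (k - 1)"
  proof (rule bias_le[OF m])
    fix v assume v: "norm2 d v = 1"
    have "(\<integral>\<^sup>+ X. ennreal \<bar>inner_d d (\<lambda>i. sample_mean m X i - clip d \<rho> u (sample_mean m X) i) v\<bar> \<partial>iid_sample m D)
      \<le> (\<integral>\<^sup>+ X. ennreal ((\<bar>\<Sum>j<m. inner_d d (dev (X j)) v\<bar> / m + \<rho> / (2 * sqrt d))
        * of_bool (4 * B < norm2 d (\<lambda>i. \<Sum>j<m. dev (X j) i))) \<partial>PiM {..<m} (\<lambda>_. D))"
      unfolding iid_sample_def by (intro nn_integral_mono ennreal_leI pw v)
    also have "\<dots> \<le> ennreal ((11 + 5 * C) * h powr (k - 1))"
    proof (cases "m = 1")
      case True
      have "(\<integral>\<^sup>+ X. ennreal ((\<bar>\<Sum>j<m. inner_d d (dev (X j)) v\<bar> / m + \<rho> / (2 * sqrt d))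
        * of_bool (4 * B < norm2 d (\<lambda>i. \<Sum>j<m. dev (X j) i))) \<partial>PiM {..<m} (\<lambda>_. D))
        = (\<integral>\<^sup>+ y. ennreal ((\<bar>inner_d d (dev y) v\<bar> + \<rho> / (2 * sqrt d)) * of_bool (\<rho> / 2 < norm2 d (dev y))) \<partial>D)"
        using nn_integral_iid_component[of "{..<m}" 0 "\<lambda>y. ennreal ((\<bar>inner_d d (dev y) v\<bar> + \<rho> / (2 * sqrt d))
            * of_bool (\<rho> / 2 < norm2 d (dev y)))"] True
        by (simp add: B_def)
      also have "\<dots> \<le> ennreal (6 * h powr (k - 1))"
        using clip_expectation_one_sample[OF \<rho> v] True by (simp add: h_def B_def)
      also have "\<dots> \<le> ennreal ((11 + 5 * C) * h powr (k - 1))"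
        using C by (intro ennreal_leI mult_right_mono) auto
      finally show ?thesis .
    next
      case False
      then show ?thesis
        using clip_expectation_many_samples[OF \<rho> v, of m] y m by (simp add: h_def B_def C_def)
    qed
    finally show "(\<integral>\<^sup>+ X. ennreal \<bar>inner_d d (\<lambda>i. sample_mean m X i - clip d \<rho> u (sample_mean m X) i) v\<bar> \<partial>iid_sample m D)
      \<le> ennreal ((11 + 5 * C) * h powr (k - 1))" .
  qed (use C \<rho> in auto)
  also have "h powr (k - 1) = 8 powr (k - 1) * (sqrt d / (m * \<rho>)) powr (k - 1)"
    using \<rho> m by (simp add: h_def B_def mult.commute flip: powr_mult)
  finally show ?thesis by (simp add: mult.assoc)
qed

end

text \<open>The root is undone by raising to the power \<open>k\<close>; an infinite moment is
  excluded separately because its root is infinite. The vectors \<open>\<mu>\<close> and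
  \<open>vec_expectation\<close> need agree only below \<open>d\<close>, where
  \<open>inner_d\<close> looks.\<close>

lemma moment_boundI:
  assumes "k > 2" "d \<ge> 1" "distribution_on_Rd d D" "has_mean d D \<mu>" and \<sigma>: "sigma_k k d D \<le> 1"
  shows "moment_bound D k d \<mu>"
proof -
  have "(\<integral>\<^sup>+ y. ennreal (\<bar>inner_d d (\<lambda>i. y i - \<mu> i) v\<bar> powr k) \<partial>D) \<le> 1" (is "?I \<le> 1")
    if v: "norm2 d v = 1" for v
  proof -
    have "inner_d d (\<lambda>i. y i - vec_expectation D (\<lambda>y. y) i) v = inner_d d (\<lambda>i. y i - \<mu> i) v" for y
      using assms(4) by (simp add: inner_d_def has_mean_def)
    then have root: "ennreal_root k ?I \<le> 1"
      using v by (intro order_trans[OF _ \<sigma>]) (auto simp: sigma_k_def intro!: SUP_upper2[of v])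
    show ?thesis
    proof (cases ?I)
      case (real x)
      then have "x powr (1 / k) \<le> 1" using root by (simp add: ennreal_root_def)
      then have "(x powr (1 / k)) powr k \<le> 1" using assms(1) powr_mono2[of k "x powr (1 / k)" 1] by simp
      then show ?thesis using real assms(1) by (simp add: powr_powr)
    next
      case top
      then show ?thesis using root by (simp add: ennreal_root_def top_unique)
    qed
  qed
  then show ?thesis
    using assms by (simp add: moment_bound_def moment_bound_axioms_def distribution_on_Rd_def)
qed

theorem theorem4p18:
  fixes k :: real
  assumes "k > 2"
  shows "\<exists>(t1 :: nat \<Rightarrow> nat \<Rightarrow> real) (A :: real) (C :: real) (a :: real).
    (\<forall>d\<ge>1. \<forall>m\<ge>1. \<bar>t1 d m\<bar> \<le> A * sqrt (real d * ln (real m) / real m)) \<and>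
    (\<forall>(d :: nat) (m :: nat) (D :: (nat \<Rightarrow> real) measure)
        (\<mu> :: nat \<Rightarrow> real) (u :: nat \<Rightarrow> real) (\<rho> :: real).
       d \<ge> 1 \<longrightarrow> m \<ge> 1 \<longrightarrow>
       distribution_on_Rd d D \<longrightarrow> has_mean d D \<mu> \<longrightarrow> sigma_k k d D \<le> 1 \<longrightarrow>
       \<rho> \<ge> 0 \<longrightarrow> \<rho> \<ge> t1 d m \<longrightarrow>
       norm2 d (\<lambda>i. u i - \<mu> i) \<le> \<rho> / (2 * sqrt (real d)) \<longrightarrow>
       norm2 d (\<lambda>i. \<mu> i -
           vec_expectation (iid_sample m D) (\<lambda>X. clip d \<rho> u (sample_mean m X)) i)
         \<le> C * (1 + ln (real m)) powr a
             * (sqrt (real d) / (real m * \<rho>)) powr (k - 1))"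
proof -
  define A where "A = sqrt (64 * k * exp k)"
  define C where "C = (11 + 5 * (2 * exp 1 * (1 + k powr k * exp k powr k))) * 8 powr (k - 1)"
  have "norm2 d (\<lambda>i. \<mu> i - vec_expectation (iid_sample m D) (\<lambda>X. clip d \<rho> u (sample_mean m X)) i)
         \<le> C * (1 + ln (real m)) powr 0 * (sqrt (real d) / (real m * \<rho>)) powr (k - 1)"
    if hyps: "d \<ge> 1" "m \<ge> 1" "distribution_on_Rd d D" "has_mean d D \<mu>" "sigma_k k d D \<le> 1" "\<rho> \<ge> 0"
      "\<rho> \<ge> A * sqrt (real d * ln (real m) / real m)"
      "norm2 d (\<lambda>i. u i - \<mu> i) \<le> \<rho> / (2 * sqrt (real d))"
    for d m :: nat and D and \<mu> u :: "nat \<Rightarrow> real" and \<rho> :: real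
  proof (cases "\<rho> = 0")
    \<comment> \<open>At \<open>\<rho> = 0\<close> division by zero makes the right side 0, so the
      bias must vanish exactly: \<open>u\<close> agrees with \<open>\<mu>\<close> below
      \<open>d\<close>, and clipping to radius 0 returns \<open>u\<close> there.\<close>
    case True
    interpret moment_bound D k d \<mu> using assms hyps by (intro moment_boundI) auto
    interpret M: prob_space "iid_sample m D"
      unfolding iid_sample_def by (rule prob_space_PiM[OF prob_space_axioms])
    have "norm2 d (\<lambda>i. u i - \<mu> i) = 0"
      using hyps(8) norm2_nonneg[of d "\<lambda>i. u i - \<mu> i"] True by simp
    then have u: "u i = \<mu> i" if "i < d" for i
      using abs_coord_le_norm2[OF that, of "\<lambda>i. u i - \<mu> i"] by simp
    have "clip d 0 u x i = u i" if "i < d" for x i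
      using abs_coord_le_norm2[OF that, of "\<lambda>i. x i - u i"]
      by (cases "norm2 d (\<lambda>i. x i - u i) \<le> 0") (simp_all add: clip_def)
    then have "norm2 d (\<lambda>i. \<mu> i - vec_expectation (iid_sample m D) (\<lambda>X. clip d \<rho> u (sample_mean m X)) i)
        = norm2 d (\<lambda>i. 0)"
      using u by (intro norm2_cong) (simp add: vec_expectation_def True M.prob_space)
    then show ?thesis using True by (simp add: norm2_zero)
  next
    case False
    interpret moment_bound D k d \<mu> using assms hyps by (intro moment_boundI) auto
    \<comment> \<open>Positivity is needed for the factor with exponent 0 to be 1, since
      \<open>0 powr 0 = 0\<close>.\<close>
    have "1 + ln (real m) > 0" using hyps by (simp add: add_pos_nonneg)
    then show ?thesis using clip_bias[of \<rho> m u] False hyps by (simp add: A_def C_def)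
  qed
  then show ?thesis
    using assms
    by (intro exI[of _ "\<lambda>d m. A * sqrt (real d * ln (real m) / real m)"] exI[of _ A] exI[of _ C] exI[of _ 0])
      (auto simp: A_def abs_mult)
qed

end
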